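(* Let $g(z)=\dfrac{zp_1-1}{z-p_1}\cdot\dfrac{zp_2-1}{z-p_2}$ with $p_1=q^2$, $p_2=q^{-1}$. In $U_q(g,\mathfrak{s})$, the q-Serre relations (namely, $Y^+(z_1,z_2,z_3)$ is zero on the line $z_1=z_2q^{-1}=z_3q^{-2}$ and $Y^-(z_1,z_2,z_3)$ is zero on the line $z_1=z_2q=z_3q^2$) are equivalent to the following two relations: \begin{align*} &\frac{(z_3-z_1q^{-1})(z_3-z_1q^{3})(z_1-z_2q^2)}{z_3-z_1q}X^+(z_3)X^+(z_1)X^+(z_2)\\ &+\frac{(z_2-z_1q^2)(z_2-z_1q^{-1})(z_3-z_1q^{-1})(z_3-z_1q^{3})}{(z_1-z_2q^{-1})(z_3-z_1q)}X^+(z_3)X^+(z_2)X^+(z_1)\\ &-\frac{(z_1-z_3q^2)(z_1-z_3q)(z_1q-z_3q^{-1})(z_1-z_2q^2)}{(z_1-z_3)(z_3-z_1q^2)}X^+(z_1)X^+(z_2)X^+(z_3)\\ &-\frac{(z_1-z_3q^2)(z_1-z_3q)(z_1q-z_3q^{-1})(z_2-z_1q^2)(z_2-z_1q^{-1})}{(z_1-z_3)(z_3-z_1q^2)(z_1-z_2q^{-1})}X^+(z_2)X^+(z_1)X^+(z_3)=0, \end{align*} \begin{align*} &\frac{(z_3-z_1q)(z_3-z_1q^{-3})(z_1-z_2q^{-2})}{z_3-z_1q^{-1}}X^-(z_3)X^-(z_1)X^-(z_2)\\ &+\frac{(z_2-z_1q^{-2})(z_2-z_1q)(z_3-z_1q)(z_3-z_1q^{-3})}{(z_1-z_2q)(z_3-z_1q^{-1})}X^-(z_3)X^-(z_2)X^-(z_1)\\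 &-\frac{(z_1-z_3q^{-2})(z_1-z_3q^{-1})(z_1q^{-1}-z_3q)(z_1-z_2q^{-2})}{(z_1-z_3)(z_3-z_1q^{-2})}X^-(z_1)X^-(z_2)X^-(z_3)\\ &-\frac{(z_1-z_3q^{-2})(z_1-z_3q^{-1})(z_1q^{-1}-z_3q)(z_2-z_1q^{-2})(z_2-z_1q)}{(z_1-z_3)(z_3-z_1q^{-2})(z_1-z_2q)}X^-(z_2)X^-(z_1)X^-(z_3)=0, \end{align*} where each coefficient function is expanded in the expansion region of the corresponding monomial in the $X^\pm(z_j)$ (for $X^\pm(z_i)X^\pm(z_j)X^\pm(z_k)$ this is $|z_i|\gg|z_j|\gg|z_k|$).
   Context: $q$ is a nonzero generic complex parameter; $z,w,z_i$ are formal variables. $U_q(g,\mathfrak{s})$ is the $\mathbb{Z}_2$-graded algebra generated by the coefficients of currents $X^\pm(z)=x^\pm(z)=\sum_{l\in\mathbb{Z}}x^\pm(l)z^{-l}$ (odd), $\varphi(z)=\exp[\sum_{m\le0}\bar a(m)z^{-m}]\exp[\sum_{m>0}\bar a(m)z^{-m}]$, $\psi(z)=\exp[\sum_{m\le0}\bar b(m)z^{-m}]\exp[\sum_{m>0}\bar b(m)z^{-m}]$ (even) and a central even element $c$. With $\{x,y\}=xy+yx$, $\delta(z)=\sum_n z^n$ and $z/wq^s$ meaning $(z/w)q^s$, the relations are \begin{align*} &\varphi(z)\varphi(w)=\varphi(w)\varphi(z),\quad \psi(z)\psi(w)=\psi(w)\psi(z),\quad \varphi(z)\psi(w)\varphi(z)^{-1}\psi(w)^{-1}=\frac{g(z/wq^{-c})}{g(z/wq^{c})},\\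 &\varphi(z)x^\pm(w)\varphi(z)^{-1}=g(z/wq^{\mp c/2})^{\pm1}x^\pm(w),\quad \psi(z)x^\pm(w)\psi(z)^{-1}=g(w/zq^{\mp c/2})^{\mp1}x^\pm(w),\\ &\{x^+(z),x^-(w)\}=\frac{1}{q-q^{-1}}\Big(\delta(\tfrac zw q^{-c})\psi(wq^{c/2})-\delta(\tfrac zw q^{c})\varphi(zq^{c/2})\Big),\\ &(z-p_1w)(z-p_2w)X^+(z)X^+(w)=-(zp_1-w)(zp_2-w)X^+(w)X^+(z),\\ &(zp_1-w)(zp_2-w)X^-(z)X^-(w)=-(z-p_1w)(z-p_2w)X^-(w)X^-(z), \end{align*} with $g$ replaced by its Laurent expansion in a fixed annulus. Define $$Y^{\pm}(z_1,z_2,z_3)=\prod_{1\le i<j\le3}\frac{(z_i-p_1^{\pm1}z_j)(z_i-p_2^{\pm1}z_j)}{z_i-z_j}\;X^\pm(z_1)X^\pm(z_2)X^\pm(z_3).$$ Products of currents are regarded as operator-valued functions: $X^\pm(z_i)X^\pm(z_j)X^\pm(z_k)$ is the expansion in $|z_i|\gg|z_j|\gg|z_k|$ of a meromorphic function, and $Y^\pm(z_1,z_2,z_3)$ is the corresponding function, which is symmetric in $z_1,z_2,z_3$ and has no poles (away from coordinates equal to $0$ or $\infty$), so its restriction to the stated lines makes sense. *)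

theory Defs
  imports "HOL-Analysis.Analysis"
begin

section \<open>Laurent series in three variables\<close>

text \<open>
  Formal variables \<open>z\<^sub>1, z\<^sub>2, z\<^sub>3\<close> are the components of \<open>z :: complex ^ 3\<close>; a formal Laurent series
  (infinite in all directions) is its family of coefficients \<open>int ^ 3 \<Rightarrow> complex\<close>.
\<close>

definition torus :: "(complex ^ 3) set" where
  "torus = {z. \<forall>i. z $ i \<noteq> 0}"

definition monomial :: "int ^ 3 \<Rightarrow> complex ^ 3 \<Rightarrow> complex" where
  "monomial n z = (\<Prod>i\<in>UNIV. (z $ i) powi (n $ i))"

text \<open>The regions \<open>|z\<^sub>i| > \<rho> |z\<^sub>j|\<close>, \<open>|z\<^sub>j| > \<rho> |z\<^sub>k|\<close>; the notation \<open>|z\<^sub>i| \<ggreater> |z\<^sub>j| \<ggreater> |z\<^sub>k|\<close> means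
  that \<open>\<rho>\<close> is allowed to be as large as necessary.\<close>

definition region :: "3 \<Rightarrow> 3 \<Rightarrow> 3 \<Rightarrow> real \<Rightarrow> (complex ^ 3) set" where
  "region i j k \<rho> =
     {z \<in> torus. norm (z $ i) > \<rho> * norm (z $ j) \<and> norm (z $ j) > \<rho> * norm (z $ k)}"

definition expands_in ::
  "3 \<Rightarrow> 3 \<Rightarrow> 3 \<Rightarrow> (complex ^ 3 \<Rightarrow> complex) \<Rightarrow> (int ^ 3 \<Rightarrow> complex) \<Rightarrow> bool" where
  "expands_in i j k F r \<longleftrightarrow>
     (\<exists>\<rho>>0. \<forall>z\<in>region i j k \<rho>. ((\<lambda>n. r n * monomial n z) has_sum F z) UNIV)"

definition expansion ::
  "3 \<Rightarrow> 3 \<Rightarrow> 3 \<Rightarrow> (complex ^ 3 \<Rightarrow> complex) \<Rightarrow> int ^ 3 \<Rightarrow> complex" where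
  "expansion i j k F = (THE r. expands_in i j k F r)"

definition series_mult ::
  "(int ^ 3 \<Rightarrow> complex) \<Rightarrow> (int ^ 3 \<Rightarrow> complex) \<Rightarrow> int ^ 3 \<Rightarrow> complex" where
  "series_mult r s n = (\<Sum>\<^sub>\<infinity>m. r m * s (n - m))"

text \<open>Holomorphic functions of three variables on the torus: continuous and holomorphic in each
  variable separately.\<close>

definition holomorphic_on_torus :: "(complex ^ 3 \<Rightarrow> complex) \<Rightarrow> bool" where
  "holomorphic_on_torus F \<longleftrightarrow>
     continuous_on torus F \<and>
     (\<forall>z\<in>torus. \<forall>i. (\<lambda>w. F (\<chi> j. if j = i then w else z $ j)) holomorphic_on (- {0}))"


section \<open>Representations of \<open>U\<^sub>q(g,s)\<close>\<close>

definition g_fun :: "complex \<Rightarrow> complex \<Rightarrow> complex \<Rightarrow> complex" where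
  "g_fun p1 p2 z = (z * p1 - 1) / (z - p1) * ((z * p2 - 1) / (z - p2))"

definition laurent_on_annulus ::
  "real \<Rightarrow> real \<Rightarrow> (complex \<Rightarrow> complex) \<Rightarrow> (int \<Rightarrow> complex) \<Rightarrow> bool" where
  "laurent_on_annulus r R f cs \<longleftrightarrow>
     (\<forall>z. r < norm z \<and> norm z < R \<longrightarrow> ((\<lambda>k. cs k * z powi k) has_sum f z) UNIV)"

text \<open>
  The relations of \<open>U\<^sub>q(g,s)\<close> contain products of currents that are infinite in both directions, so
  they are imposed on operators on a \<open>\<int>\<^sub>2\<close>-graded complex vector space. Infinite sums of operators
  are understood through their matrix coefficients \<open>v \<mapsto> f (T v)\<close>, where \<open>f\<close> runs through a separating
  set \<open>W\<close> of linear functionals that is stable under the transposed operators (for instance a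
  restricted dual).

  Coefficients are indexed by \<open>x(z) = \<Sum>\<^sub>n x n z\<^sup>-\<^sup>n\<close>. The operator \<open>qc k\<close> is \<open>q\<^bsup>kc/2\<^esup> = exp (k h c / 2)\<close>,
  where \<open>h\<close> is a logarithm of \<open>q\<close>; \<open>gp\<close> and \<open>gm\<close> are the Laurent coefficients of \<open>g\<close> and \<open>g\<^sup>-\<^sup>1\<close>.
  A relation \<open>A(z) B(w) A(z)\<^sup>-\<^sup>1 = G B(w)\<close> is read as \<open>A(z) B(w) = G B(w) A(z)\<close>.
\<close>

text \<open>\<open>E(z) = exp (\<Sum>\<^bsub>m \<le> 0\<^esub> a m z\<^sup>-\<^sup>m) exp (\<Sum>\<^bsub>m > 0\<^esub> a m z\<^sup>-\<^sup>m)\<close>; the two lists are the words in the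
  \<open>a m\<close> occurring in the powers of the two exponents.\<close>

definition exp_current ::
  "('v \<Rightarrow> complex) set \<Rightarrow> (int \<Rightarrow> 'v \<Rightarrow> 'v) \<Rightarrow> (int \<Rightarrow> 'v \<Rightarrow> 'v) \<Rightarrow> bool" where
  "exp_current W a E \<longleftrightarrow>
     (\<forall>f\<in>W. \<forall>v n.
        ((\<lambda>(ms, ns). f (foldr a ms (foldr a ns v)) / (fact (length ms) * fact (length ns)))
          has_sum f (E n v))
        {(ms, ns). (\<forall>m\<in>set ms. m \<le> 0) \<and> (\<forall>m\<in>set ns. m > 0) \<and> sum_list ms + sum_list ns = n})"

locale Uq_representation = vector_space scale
  for scale :: "complex \<Rightarrow> 'v::ab_group_add \<Rightarrow> 'v" +
  fixes q h p1 p2 :: complex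
    and r R :: real
    and gp gm :: "int \<Rightarrow> complex"
    and W :: "('v \<Rightarrow> complex) set"
    and parity :: "'v \<Rightarrow> 'v"
    and xp xm a b \<phi> \<psi> qc :: "int \<Rightarrow> 'v \<Rightarrow> 'v"
    and c :: "'v \<Rightarrow> 'v"
  assumes log_q: "exp h = q"
    and annulus: "0 \<le> r" "r < R"
      "\<And>z. r < norm z \<Longrightarrow> norm z < R \<Longrightarrow> z \<noteq> p1 \<and> z \<noteq> p2 \<and> z * p1 \<noteq> 1 \<and> z * p2 \<noteq> 1"
    and g_expansion: "laurent_on_annulus r R (g_fun p1 p2) gp"
      "laurent_on_annulus r R (\<lambda>z. inverse (g_fun p1 p2 z)) gm"
    \<comment> \<open>the space of matrix coefficients\<close>
    and functional_linear: "f \<in> W \<Longrightarrow> Vector_Spaces.linear scale (*) f"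
    and separating: "(\<And>f. f \<in> W \<Longrightarrow> f v = 0) \<Longrightarrow> v = 0"
    and stable: "f \<in> W \<Longrightarrow>
      T \<in> {c} \<union> range xp \<union> range xm \<union> range a \<union> range b \<union> range \<phi> \<union> range \<psi> \<union> range qc \<Longrightarrow>
      f \<circ> T \<in> W"
    \<comment> \<open>linearity and parity\<close>
    and linear_ops:
      "T \<in> {c} \<union> range xp \<union> range xm \<union> range a \<union> range b \<union> range \<phi> \<union> range \<psi> \<union> range qc \<Longrightarrow>
      Vector_Spaces.linear scale scale T"
    and parity_linear: "Vector_Spaces.linear scale scale parity"
    and parity_involution: "parity (parity v) = v"
    and even_ops: "T \<in> {c} \<union> range a \<union> range b \<union> range \<phi> \<union> range \<psi> \<Longrightarrow> parity (T v) = T (parity v)"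
    and odd_ops: "T \<in> range xp \<union> range xm \<Longrightarrow> parity (T v) = - T (parity v)"
    \<comment> \<open>the central element and its exponentials\<close>
    and central: "T \<in> range xp \<union> range xm \<union> range a \<union> range b \<union> range \<phi> \<union> range \<psi> \<Longrightarrow>
      c (T v) = T (c v)"
    and qc_exp: "f \<in> W \<Longrightarrow>
      ((\<lambda>n. (of_int k * h / 2) ^ n / fact n * f ((c ^^ n) v)) has_sum f (qc k v)) UNIV"
    and phi_exp: "exp_current W a \<phi>"
    and psi_exp: "exp_current W b \<psi>"
    \<comment> \<open>the defining relations, coefficientwise\<close>
    and phi_phi: "\<phi> m (\<phi> n v) = \<phi> n (\<phi> m v)"
    and psi_psi: "\<psi> m (\<psi> n v) = \<psi> n (\<psi> m v)"
    and phi_psi: "f \<in> W \<Longrightarrow>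
      ((\<lambda>(i, j). gp i * gm j * f (qc (2 * (j - i)) (\<psi> (n - (i + j)) (\<phi> (m + (i + j)) v))))
        has_sum f (\<phi> m (\<psi> n v))) UNIV"
    and phi_xp: "f \<in> W \<Longrightarrow>
      ((\<lambda>k. gp k * f (qc (- k) (xp (n - k) (\<phi> (m + k) v)))) has_sum f (\<phi> m (xp n v))) UNIV"
    and phi_xm: "f \<in> W \<Longrightarrow>
      ((\<lambda>k. gm k * f (qc k (xm (n - k) (\<phi> (m + k) v)))) has_sum f (\<phi> m (xm n v))) UNIV"
    and psi_xp: "f \<in> W \<Longrightarrow>
      ((\<lambda>k. gm k * f (qc (- k) (xp (n + k) (\<psi> (m - k) v)))) has_sum f (\<psi> m (xp n v))) UNIV"
    and psi_xm: "f \<in> W \<Longrightarrow>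
      ((\<lambda>k. gp k * f (qc k (xm (n + k) (\<psi> (m - k) v)))) has_sum f (\<psi> m (xm n v))) UNIV"
    and xp_xm: "xp m (xm n v) + xm n (xp m v) =
      scale (1 / (q - inverse q)) (qc (m - n) (\<psi> (m + n) v) - qc (n - m) (\<phi> (m + n) v))"
    \<comment> \<open>coefficient of \<open>z\<^sup>-\<^sup>m w\<^sup>-\<^sup>n\<close> in the quadratic relations\<close>
    and xp_xp:
      "xp (m + 2) (xp n v) - scale (p1 + p2) (xp (m + 1) (xp (n + 1) v))
         + scale (p1 * p2) (xp m (xp (n + 2) v)) =
       - (scale (p1 * p2) (xp n (xp (m + 2) v)) - scale (p1 + p2) (xp (n + 1) (xp (m + 1) v))
         + xp (n + 2) (xp m v))"
    and xm_xm:
      "scale (p1 * p2) (xm (m + 2) (xm n v)) - scale (p1 + p2) (xm (m + 1) (xm (n + 1) v))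
         + xm m (xm (n + 2) v) =
       - (xm n (xm (m + 2) v) - scale (p1 + p2) (xm (n + 1) (xm (m + 1) v))
         + scale (p1 * p2) (xm (n + 2) (xm m v)))"


section \<open>Triple products of currents\<close>

text \<open>The matrix coefficient of \<open>X(z\<^sub>i) X(z\<^sub>j) X(z\<^sub>k)\<close> at \<open>f\<close> and \<open>v\<close>.\<close>

definition triple ::
  "(int \<Rightarrow> 'v \<Rightarrow> 'v) \<Rightarrow> ('v \<Rightarrow> complex) \<Rightarrow> 'v \<Rightarrow> 3 \<Rightarrow> 3 \<Rightarrow> 3 \<Rightarrow> int ^ 3 \<Rightarrow> complex" where
  "triple x f v i j k n = f (x (- (n $ i)) (x (- (n $ j)) (x (- (n $ k)) v)))"

definition Y_factor :: "complex \<Rightarrow> complex \<Rightarrow> complex ^ 3 \<Rightarrow> complex" where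
  "Y_factor p1 p2 z =
     (z $ 1 - p1 * z $ 2) * (z $ 1 - p2 * z $ 2) / (z $ 1 - z $ 2) *
     ((z $ 1 - p1 * z $ 3) * (z $ 1 - p2 * z $ 3) / (z $ 1 - z $ 3)) *
     ((z $ 2 - p1 * z $ 3) * (z $ 2 - p2 * z $ 3) / (z $ 2 - z $ 3))"

text \<open>\<open>Y\<close> is the function (unique, by the identity theorem) \<open>Y_factor \<cdot> X(z\<^sub>1) X(z\<^sub>2) X(z\<^sub>3)\<close>, where the
  product of currents is the expansion of the meromorphic function \<open>Y / Y_factor\<close>. The expansions in
  the other orders arise by renaming the variables. Symmetry of \<open>Y\<close> is not demanded: it follows from
  the quadratic relations.\<close>

definition is_Y_function ::
  "complex \<Rightarrow> complex \<Rightarrow> (int \<Rightarrow> 'v \<Rightarrow> 'v) \<Rightarrow> ('v \<Rightarrow> complex) \<Rightarrow> 'v \<Rightarrow>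
   (complex ^ 3 \<Rightarrow> complex) \<Rightarrow> bool" where
  "is_Y_function p1 p2 x f v Y \<longleftrightarrow>
     holomorphic_on_torus Y \<and>
     expands_in 1 2 3 (\<lambda>z. Y z / Y_factor p1 p2 z) (triple x f v 1 2 3)"

definition coeff312 :: "complex \<Rightarrow> complex \<Rightarrow> complex \<Rightarrow> complex \<Rightarrow> complex" where
  "coeff312 q z1 z2 z3 =
     (z3 - z1 * inverse q) * (z3 - z1 * q ^ 3) * (z1 - z2 * q ^ 2) / (z3 - z1 * q)"

definition coeff321 :: "complex \<Rightarrow> complex \<Rightarrow> complex \<Rightarrow> complex \<Rightarrow> complex" where
  "coeff321 q z1 z2 z3 =
     (z2 - z1 * q ^ 2) * (z2 - z1 * inverse q) * (z3 - z1 * inverse q) * (z3 - z1 * q ^ 3) /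
     ((z1 - z2 * inverse q) * (z3 - z1 * q))"

definition coeff123 :: "complex \<Rightarrow> complex \<Rightarrow> complex \<Rightarrow> complex \<Rightarrow> complex" where
  "coeff123 q z1 z2 z3 =
     (z1 - z3 * q ^ 2) * (z1 - z3 * q) * (z1 * q - z3 * inverse q) * (z1 - z2 * q ^ 2) /
     ((z1 - z3) * (z3 - z1 * q ^ 2))"

definition coeff213 :: "complex \<Rightarrow> complex \<Rightarrow> complex \<Rightarrow> complex \<Rightarrow> complex" where
  "coeff213 q z1 z2 z3 =
     (z1 - z3 * q ^ 2) * (z1 - z3 * q) * (z1 * q - z3 * inverse q) *
     (z2 - z1 * q ^ 2) * (z2 - z1 * inverse q) /
     ((z1 - z3) * (z3 - z1 * q ^ 2) * (z1 - z2 * inverse q))"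

text \<open>The summand with coefficient function \<open>C\<close> and monomial \<open>X(z\<^sub>i) X(z\<^sub>j) X(z\<^sub>k)\<close>.\<close>

definition cubic_term ::
  "(complex \<Rightarrow> complex \<Rightarrow> complex \<Rightarrow> complex) \<Rightarrow> 3 \<Rightarrow> 3 \<Rightarrow> 3 \<Rightarrow>
   (int \<Rightarrow> 'v \<Rightarrow> 'v) \<Rightarrow> ('v \<Rightarrow> complex) \<Rightarrow> 'v \<Rightarrow> int ^ 3 \<Rightarrow> complex" where
  "cubic_term C i j k x f v =
     series_mult (expansion i j k (\<lambda>z. C (z $ 1) (z $ 2) (z $ 3))) (triple x f v i j k)"

text \<open>The relation for \<open>X\<^sup>+\<close> has parameter \<open>q\<close>; the relation for \<open>X\<^sup>-\<close> is the same expression with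
  \<open>q\<close> replaced by \<open>q\<^sup>-\<^sup>1\<close>.\<close>

definition cubic_relation ::
  "complex \<Rightarrow> (int \<Rightarrow> 'v \<Rightarrow> 'v) \<Rightarrow> ('v \<Rightarrow> complex) \<Rightarrow> 'v \<Rightarrow> bool" where
  "cubic_relation q x f v \<longleftrightarrow>
     (\<forall>n. cubic_term (coeff312 q) 3 1 2 x f v n
        + cubic_term (coeff321 q) 3 2 1 x f v n
        - cubic_term (coeff123 q) 1 2 3 x f v n
        - cubic_term (coeff213 q) 2 1 3 x f v n = 0)"

end

theory Submission
  imports Defs "HOL-Complex_Analysis.Conformal_Mappings"
begin

text \<open>
  Multiplied by its six linear denominators, the series \<open>X(z\<^sub>1) X(z\<^sub>2) X(z\<^sub>3)\<close> becomes antisymmetric by the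
  quadratic relations. It therefore converges both for \<open>|z\<^sub>1| \<ggreater> |z\<^sub>2| \<ggreater> |z\<^sub>3|\<close> and in the
  opposite region, hence on the whole torus, and its sum \<open>H\<close> is \<open>Y\<close> times the Vandermonde product. Every term of the cubic relation is then the expansion,
  in its own region, of a rational function times \<open>H\<close>. Up to summands that cancel in pairs, the four
  rational functions are \<open>\<plusminus> 1 / ((z\<^sub>3 - z\<^sub>1) (z\<^sub>3 - q z\<^sub>1) (z\<^sub>3 - q\<^sup>2 z\<^sub>1) (z\<^sub>1 - z\<^sub>2 / q))\<close>, and the
  signed sum of the four expansions of such a kernel is a sum of products of delta functions supported
  on the lines \<open>z\<^sub>2 = q z\<^sub>1\<close>, \<open>z\<^sub>3 = q\<^sup>i z\<^sub>1\<close> with \<open>i = 0, 1, 2\<close>. On the first two lines the Vandermonde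
  factor vanishes, so the cubic relation says precisely that \<open>Y\<close> vanishes on the third.
\<close>

section \<open>Graded series\<close>

text \<open>The obstacle is that a delta function cannot be multiplied by an arbitrary series
  infinite in all directions. Convergence of the cleared product at every point of the torus removes
  it: multiplied by a product of two deltas, \<open>H\<close> is simply evaluated on a line, and
  only a grading by total degree remains. The kernel comes from a comparison of residues. Divided by
  the denominators of their words, the two coefficients of words beginning with
  \<open>X(z_3)\<close> become one and the same rational function, and so do the two of words ending
  with \<open>X(z_3)\<close>. Both functions have the same residue along \<open>z_2 = q z_1\<close>
  as the kernel. What is left after subtracting it has no pole relating \<open>z_1\<close> and
  \<open>z_2\<close>, so its expansion does not see the order of these two variables, while
  antisymmetry gives the two words opposite signs. The relation for \<open>X^-\<close> is the
  relation for \<open>X^+\<close> at \<open>inverse q\<close>, because dividing its quadratic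
  relation by \<open>p1 * p2\<close> inverts both parameters.\<close>

lemma sum_roots_of_unity_powi:
  assumes "N > 0"
  shows "(\<Sum>i<N. (cis (2 * pi / N) ^ i) powi m) = (if int N dvd m then of_nat N else 0)"
proof -
  define w where "w = cis (2 * pi / N) powi m"
  have *: "(cis (2 * pi / N) ^ i) powi m = w ^ i" for i
    unfolding w_def by (metis power_int_mult mult.commute power_int_of_nat)
  have w: "w = cis (2 * pi * m / N)"
    unfolding w_def by (simp add: cis_power_int mult_ac)
  have wN: "w ^ N = 1"
  proof -
    have "w ^ N = cis (N * (2 * pi * m / N))"
      unfolding w by (rule Complex.DeMoivre)
    also have "N * (2 * pi * m / N) = 2 * pi * m"
      using assms by simp
    finally have "w ^ N = cis (2 * pi * m)" .
    then show ?thesis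
      using cis_multiple_2pi[of "real_of_int m"] by simp
  qed
  have w1: "w = 1 \<longleftrightarrow> int N dvd m"
  proof
    assume "w = 1"
    then have "cos (2 * pi * m / N) = 1"
      by (simp add: w complex_eq_iff)
    then obtain k :: int where "2 * pi * m / N = of_int k * 2 * pi"
      using cos_one_2pi_int by blast
    then have "real_of_int m = real_of_int (k * int N)"
      using assms by (simp add: field_simps)
    then have "m = k * int N"
      by linarith
    then show "int N dvd m" by simp
  next
    assume "int N dvd m"
    then obtain k where "m = int N * k" by blast
    then have "2 * pi * m / N = 2 * pi * k"
      using assms by simp
    then show "w = 1"
      using cis_multiple_2pi[of "real_of_int k"] by (simp add: w)
  qed
  have "(\<Sum>i<N. w ^ i) = (if w = 1 then of_nat N else 0)"
    using wN by (simp add: sum_gp_strict)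
  then show ?thesis
    by (simp add: * w1)
qed

lemma has_sum_sum:
  fixes f :: "'b \<Rightarrow> 'a \<Rightarrow> 'c::topological_comm_monoid_add"
  assumes "finite I" and "\<And>i. i \<in> I \<Longrightarrow> (f i has_sum s i) A"
  shows "((\<lambda>x. \<Sum>i\<in>I. f i x) has_sum (\<Sum>i\<in>I. s i)) A"
  using assms by (induction I) (auto intro: has_sum_add)

lemma has_sum_diff:
  fixes f g :: "'a \<Rightarrow> 'b::topological_ab_group_add"
  shows "(f has_sum a) A \<Longrightarrow> (g has_sum b) A \<Longrightarrow> ((\<lambda>x. f x - g x) has_sum (a - b)) A"
  using has_sum_add[where f = f and g = "\<lambda>x. - g x" and b = "- b"] by (simp add: has_sum_uminus)

text \<open>Averaging over the \<open>N\<close>-th roots of unity isolates the degrees congruent to \<open>k\<close> modulo \<open>N\<close>;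
  the degrees other than \<open>k\<close> disappear as \<open>N\<close> tends to infinity.\<close>

lemma graded_part_eq_0:
  fixes a :: "'a \<Rightarrow> complex" and g :: "'a \<Rightarrow> int"
  assumes 0: "\<And>u. norm u = 1 \<Longrightarrow> ((\<lambda>n. a n * u powi g n) has_sum 0) A"
  shows "infsum a {n\<in>A. g n = k} = 0"
proof -
  define X where "X = infsum a {n\<in>A. g n = k}"
  have summ: "a summable_on A"
    using 0[of 1] by (auto intro: has_sum_imp_summable)
  have nsumm: "(\<lambda>n. norm (a n)) summable_on A"
    using summ summable_on_iff_abs_summable_on_complex by auto
  define M where "M = (\<Sum>\<^sub>\<infinity>n\<in>A. norm (a n))"
  have M: "((\<lambda>n. norm (a n)) has_sum M) A"
    using nsumm by (simp add: M_def)
  have "norm X \<le> e" if "e > 0" for e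
  proof -
    obtain F where F: "finite F" "F \<subseteq> A" "dist (\<Sum>n\<in>F. norm (a n)) M \<le> e"
      using has_sum_finite_approximation[OF M \<open>e > 0\<close>] by auto
    \<comment> \<open>\<open>N\<close> exceeds every \<open>\<bar>g n - k\<bar>\<close> with
      \<open>n \<in> F\<close>, so on \<open>F\<close> divisibility of \<open>g n - k\<close> by
      \<open>N\<close> already forces \<open>g n = k\<close>.\<close>
    define N where "N = nat (1 + (\<Sum>n\<in>F. \<bar>g n - k\<bar>))"
    have S0: "(\<Sum>n\<in>F. \<bar>g n - k\<bar>) \<ge> 0"
      by (simp add: sum_nonneg)
    then have N: "N > 0" "int N = 1 + (\<Sum>n\<in>F. \<bar>g n - k\<bar>)"
      unfolding N_def by linarith+
    have small: "\<bar>g n - k\<bar> < int N" if "n \<in> F" for n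
      using member_le_sum[OF that, of "\<lambda>n. \<bar>g n - k\<bar>"] F(1) N(2) by simp
    have "((\<lambda>n. \<Sum>i<N. a n * (cis (2 * pi / N) ^ i) powi (g n - k)) has_sum (\<Sum>i<N. 0)) A"
    proof (rule has_sum_sum)
      fix i assume "i \<in> {..<N}"
      define u where "u = cis (2 * pi / N) ^ i"
      have u: "norm u = 1" "u \<noteq> 0"
        by (auto simp: u_def norm_power)
      have "((\<lambda>n. a n * u powi g n * u powi (- k)) has_sum 0 * u powi (- k)) A"
        by (intro has_sum_cmult_left 0 u)
      then show "((\<lambda>n. a n * (cis (2 * pi / N) ^ i) powi (g n - k)) has_sum 0) A"
        unfolding u_def[symmetric] using u(2)
        by (simp add: power_int_diff power_int_minus divide_inverse mult.assoc)
    qed auto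
    then have "((\<lambda>n. a n * (if int N dvd g n - k then of_nat N else 0)) has_sum 0) A"
      using N(1) by (simp add: sum_distrib_left[symmetric] sum_roots_of_unity_powi)
    then have "((\<lambda>n. inverse (of_nat N) * (a n * (if int N dvd g n - k then of_nat N else 0))) has_sum
        inverse (of_nat N) * 0) A"
      by (rule has_sum_cmult_right)
    moreover have "inverse (of_nat N) * (a n * (if int N dvd g n - k then of_nat N else 0)) =
        (if int N dvd g n - k then a n else 0)" for n
      using N(1) by simp
    ultimately have dvd0: "((\<lambda>n. if int N dvd g n - k then a n else 0) has_sum 0) A"
      by simp
    have "(a has_sum X) {n\<in>A. g n = k}"
      unfolding X_def by (intro has_sum_infsum summable_on_subset[OF summ]) auto
    then have "((\<lambda>n. if g n = k then a n else 0) has_sum X) A"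
      by (subst has_sum_cong_neutral[where T = "{n\<in>A. g n = k}" and g = a]) auto
    from has_sum_diff[OF dvd0 this]
    have rest: "((\<lambda>n. (if int N dvd g n - k then a n else 0) - (if g n = k then a n else 0)) has_sum - X) A"
      by simp
    have "((\<lambda>n. norm (a n)) has_sum (M - (\<Sum>n\<in>F. norm (a n)))) (A - F)"
      using F by (intro has_sum_Diff M has_sum_finite) auto
    then have tail: "((\<lambda>n. if n \<in> F then 0 else norm (a n)) has_sum (M - (\<Sum>n\<in>F. norm (a n)))) A"
      by (subst has_sum_cong_neutral[where T = "A - F" and g = "\<lambda>n. norm (a n)"]) auto
    \<comment> \<open>The two indicator sums agree on \<open>F\<close>, so their difference is
      bounded by the tail of the norms outside \<open>F\<close>.\<close>
    have "norm (- X) \<le> M - (\<Sum>n\<in>F. norm (a n))"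
    proof (rule norm_infsum_le[OF rest tail])
      fix n assume "n \<in> A"
      have "g n = k" if "n \<in> F" "int N dvd g n - k"
        using small[OF that(1)] that(2) zdvd_imp_le[of "int N" "\<bar>g n - k\<bar>"] by force
      then show "norm ((if int N dvd g n - k then a n else 0) - (if g n = k then a n else 0))
          \<le> (if n \<in> F then 0 else norm (a n))"
        by auto
    qed
    then show "norm X \<le> e"
      using F(3) by (simp add: dist_norm abs_le_iff)
  qed
  then have "norm X \<le> 0"
    by (meson field_le_epsilon add_0 dense_ge linorder_not_le)
  then show ?thesis
    by (simp add: X_def)
qed

text \<open>Converse of \<open>graded_part_eq_0\<close>: the sum may be regrouped by degree, and the
  factor \<open>u powi k\<close> is constant on each degree. A single \<open>u\<close> is enough
  here.\<close>

lemma graded_parts_0_imp_has_sum_0: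
  fixes a :: "'a \<Rightarrow> complex" and g :: "'a \<Rightarrow> int"
  assumes sum: "((\<lambda>n. a n * u powi g n) has_sum s) UNIV" and "u \<noteq> 0"
    and 0: "\<And>k. infsum a {n. g n = k} = 0"
  shows "s = 0"
proof -
  define f where "f n = a n * u powi g n" for n
  have "((\<lambda>(k, n). f n) has_sum s) (SIGMA k:UNIV. {n. g n = k})"
    using sum unfolding f_def[symmetric]
    by (rule has_sum_reindex_bij_witness[where i = "\<lambda>n. (g n, n)" and j = snd, THEN iffD2, rotated -1]) auto
  moreover have "((\<lambda>n. f n) has_sum 0) {n. g n = k}" for k
  proof -
    have "f summable_on {n. g n = k}"
      using sum unfolding f_def[symmetric]
      by (meson has_sum_imp_summable summable_on_subset subset_UNIV)
    moreover have "infsum f {n. g n = k} = infsum (\<lambda>n. a n * u powi k) {n. g n = k}"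
      by (intro infsum_cong) (auto simp: f_def)
    ultimately show ?thesis
      using 0[of k] by (simp add: infsum_cmult_left' has_sum_iff)
  qed
  ultimately have "((\<lambda>k. 0) has_sum s) (UNIV :: int set)"
    by (intro has_sum_SigmaD[where f = "\<lambda>(k, n). f n" and g = "\<lambda>k. 0"]) auto
  then show ?thesis
    by (metis has_sum_0_simp has_sum_unique)
qed

text \<open>The Weierstrass M-test on closed discs avoiding 0. The index set is arbitrary and
  several indices may share a degree, as happens when a series in three variables is restricted to
  one of them.\<close>

lemma holomorphic_on_graded_sum:
  fixes a :: "'a \<Rightarrow> complex" and g :: "'a \<Rightarrow> int"
  assumes sum: "\<And>w. w \<noteq> 0 \<Longrightarrow> ((\<lambda>n. a n * w powi g n) has_sum h w) UNIV"
  shows "h holomorphic_on - {0}"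
  unfolding holomorphic_on_open[OF open_Compl[OF closed_singleton]]
proof
  fix w :: complex assume "w \<in> - {0}"
  then have "w \<noteq> 0" by simp
  define r where "r = norm w / 2"
  have r: "r > 0" using \<open>w \<noteq> 0\<close> by (simp add: r_def)
  have bounds: "r \<le> norm y" "norm y \<le> 3 * r" if "y \<in> cball w r" for y
  proof -
    have "norm (w - y) \<le> r" using that by (simp add: dist_norm)
    then show "r \<le> norm y" "norm y \<le> 3 * r"
      using norm_triangle_ineq2[of w y] norm_triangle_ineq3[of w y] unfolding r_def by linarith+
  qed
  \<comment> \<open>On the interval from \<open>r\<close> to \<open>3 * r\<close> a power of either
    sign is at most the sum of its values at the endpoints, so one majorant serves all integer
    exponents.\<close>
  define M where "M n = norm (a n) * (r powi g n + (3 * r) powi g n)" for n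
  have M: "M summable_on UNIV"
  proof -
    have "(\<lambda>n. norm (a n * of_real t powi g n)) summable_on UNIV" if "t > 0" for t :: real
      using sum[of "of_real t"] that summable_on_iff_abs_summable_on_complex
      by (metis has_sum_imp_summable of_real_eq_0_iff order_less_irrefl)
    from this[of r] this[of "3 * r"] r
    have "(\<lambda>n. norm (a n) * r powi g n) summable_on UNIV"
      "(\<lambda>n. norm (a n) * (3 * r) powi g n) summable_on UNIV"
      by (simp_all add: norm_mult norm_power_int)
    then show ?thesis
      unfolding M_def distrib_left by (rule summable_on_add)
  qed
  have "uniform_limit (cball w r) (\<lambda>X y. \<Sum>n\<in>X. a n * y powi g n) h (finite_subsets_at_top UNIV)"
  proof (rule Weierstrass_m_test_general'[OF _ _ M])
    fix n y assume "y \<in> cball w r"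
    note b = bounds[OF this]
    have "norm y powi g n \<le> r powi g n + (3 * r) powi g n"
    proof (cases "g n \<ge> 0")
      case True
      then have "norm y powi g n \<le> (3 * r) powi g n"
        using b r by (intro power_int_mono) auto
      then show ?thesis using r by (smt (verit) zero_le_power_int)
    next
      case False
      then have "norm y powi g n \<le> r powi g n"
        using b r by (intro power_int_antimono) auto
      then show ?thesis using r by (smt (verit) zero_le_power_int)
    qed
    then show "norm (a n * y powi g n) \<le> M n"
      by (simp add: M_def norm_mult norm_power_int mult_left_mono)
  next
    fix y assume "y \<in> cball w r"
    then have "y \<noteq> 0" using bounds(1)[of y] r by auto
    then show "((\<lambda>n. a n * y powi g n) has_sum h y) UNIV" by (rule sum)
  qed
  moreover have "(\<lambda>y. \<Sum>n\<in>X. a n * y powi g n) holomorphic_on cball w r" for X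
  proof -
    have "y \<noteq> 0" if "y \<in> cball w r" for y
      using bounds(1)[OF that] r by auto
    then show ?thesis by (intro holomorphic_intros) blast
  qed
  ultimately have "h holomorphic_on ball w r"
    by (rule_tac holomorphic_uniform_limit)
       (auto intro!: always_eventually holomorphic_on_imp_continuous_on
         intro: holomorphic_on_subset[OF _ ball_subset_cball])
  then show "\<exists>f'. (h has_field_derivative f') (at w)"
    using r by (metis centre_in_ball holomorphic_on_open open_ball)
qed

section \<open>Laurent series in three variables\<close>

lemma has_sum_imp_norm_summable:
  fixes f :: "'a \<Rightarrow> complex"
  shows "(f has_sum s) A \<Longrightarrow> (\<lambda>x. norm (f x)) summable_on A"
  using has_sum_imp_summable summable_on_iff_abs_summable_on_complex by blast

lemma has_sum_Times_mult:
  fixes f :: "'a \<Rightarrow> complex" and g :: "'b \<Rightarrow> complex"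
  assumes f: "(f has_sum s) A" and g: "(g has_sum t) B"
  shows "((\<lambda>(x, y). f x * g y) has_sum s * t) (A \<times> B)"
proof -
  have nf: "(\<lambda>n. norm (f n)) summable_on A" and ng: "(\<lambda>n. norm (g n)) summable_on B"
    using has_sum_imp_norm_summable[OF f] has_sum_imp_norm_summable[OF g] .
  have "(\<lambda>x. norm ((\<lambda>(m, n). f m * g n) x)) summable_on A \<times> B"
    unfolding Infinite_Sum.abs_summable_on_Sigma_iff using nf ng
    by (auto simp: norm_mult infsum_cmult_right' abs_mult
        intro: summable_on_cmult_right summable_on_cmult_left)
  then have "(\<lambda>(m, n). f m * g n) summable_on A \<times> B"
    by (rule abs_summable_summable)
  then show ?thesis
    by (intro has_sum_SigmaI[where g = "\<lambda>m. f m * t"])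
       (auto intro: has_sum_cmult_right has_sum_cmult_left f g)
qed

text \<open>Only pointwise convergence is asked for, but \<open>has_sum\<close> is unordered, hence
  absolute for complex terms. All products and regroupings below rest on this.\<close>

definition laurent_on :: "(complex ^ 3) set \<Rightarrow> (complex ^ 3 \<Rightarrow> complex) \<Rightarrow> (int ^ 3 \<Rightarrow> complex) \<Rightarrow> bool" where
  "laurent_on U F r \<longleftrightarrow> (\<forall>z\<in>U. ((\<lambda>n. r n * monomial n z) has_sum F z) UNIV)"

lemma monomial_3: "monomial n z = (z $ 1) powi (n $ 1) * (z $ 2) powi (n $ 2) * (z $ 3) powi (n $ 3)"
  unfolding monomial_def UNIV_3 by (simp add: mult.assoc)

lemma torus_3: "z \<in> torus \<longleftrightarrow> z $ 1 \<noteq> 0 \<and> z $ 2 \<noteq> 0 \<and> z $ 3 \<noteq> 0"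
  by (auto simp: torus_def forall_3)

lemma monomial_add: "z \<in> torus \<Longrightarrow> monomial (m + n) z = monomial m z * monomial n z"
  by (simp add: monomial_def torus_def power_int_add prod.distrib)

lemma monomial_times: "monomial n (w * z) = monomial n w * monomial n z"
  by (simp add: monomial_def power_int_mult_distrib prod.distrib)

lemma monomial_axis: "monomial (axis i 1) z = z $ i"
proof -
  have "monomial (axis i 1) z = (\<Prod>j\<in>UNIV. if j = i then z $ i else 1)"
    unfolding monomial_def by (intro prod.cong) (auto simp: axis_def)
  then show ?thesis by simp
qed

lemma monomial_nz: "z \<in> torus \<Longrightarrow> monomial n z \<noteq> 0"
  by (simp add: monomial_def torus_def)

lemma laurent_onD:
  "laurent_on U F r \<Longrightarrow> z \<in> U \<Longrightarrow> ((\<lambda>n. r n * monomial n z) has_sum F z) UNIV"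
  by (simp add: laurent_on_def)

lemma laurent_on_subset: "laurent_on U F r \<Longrightarrow> V \<subseteq> U \<Longrightarrow> laurent_on V F r"
  by (auto simp: laurent_on_def)

lemma laurent_on_cong: "laurent_on U F r \<Longrightarrow> (\<And>z. z \<in> U \<Longrightarrow> F z = G z) \<Longrightarrow> laurent_on U G r"
  by (simp add: laurent_on_def)

lemma laurent_on_add:
  "laurent_on U F r \<Longrightarrow> laurent_on U G s \<Longrightarrow> laurent_on U (\<lambda>z. F z + G z) (\<lambda>n. r n + s n)"
  by (auto simp: laurent_on_def distrib_right intro: has_sum_add)

lemma laurent_on_scale: "laurent_on U F r \<Longrightarrow> laurent_on U (\<lambda>z. k * F z) (\<lambda>n. k * r n)"
  by (auto simp: laurent_on_def mult.assoc intro: has_sum_cmult_right)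

lemma laurent_on_coordinate: "laurent_on U (\<lambda>z. z $ i) (\<lambda>n. if n = axis i 1 then 1 else 0)"
  unfolding laurent_on_def
proof
  fix z :: "complex ^ 3"
  show "((\<lambda>n. (if n = axis i 1 then 1 else 0) * monomial n z) has_sum z $ i) UNIV"
    by (subst has_sum_cong_neutral[where T = "{axis i 1}" and g = "\<lambda>n. monomial n z"])
       (auto simp: monomial_axis intro: has_sum_finiteI)
qed

text \<open>Both factors may be infinite in every direction, so the convolution sums are not finite.
  Absolute convergence at a common point of the torus makes them converge and allows the double sum
  to be regrouped by total exponent.\<close>

lemma laurent_on_mult:
  assumes F: "laurent_on U F r" and G: "laurent_on U G s" and U: "U \<subseteq> torus"
  shows "laurent_on U (\<lambda>z. F z * G z) (series_mult r s)"
    and "U \<noteq> {} \<Longrightarrow> (\<lambda>m. r m * s (n - m)) summable_on UNIV"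
proof -
  have key: "((\<lambda>n. series_mult r s n * monomial n z) has_sum F z * G z) UNIV \<and>
      (\<forall>n. (\<lambda>m. r m * s (n - m)) summable_on UNIV)" if z: "z \<in> U" for z
  proof -
    have zt: "z \<in> torus" using z U by blast
    define f g where "f n = r n * monomial n z" and "g n = s n * monomial n z" for n
    have f: "(f has_sum F z) UNIV" and g: "(g has_sum G z) UNIV"
      using laurent_onD[OF F z] laurent_onD[OF G z] by (auto simp: f_def[abs_def] g_def[abs_def])
    have "((\<lambda>(m, n). f m * g n) has_sum F z * G z) (UNIV \<times> UNIV)"
      by (rule has_sum_Times_mult[OF f g])
    then have prod: "((\<lambda>(n, m). f m * g (n - m)) has_sum F z * G z) (UNIV \<times> UNIV)"
      by (rule has_sum_reindex_bij_witness[where i = "\<lambda>(n, m). (m, n - m)" and j = "\<lambda>(m, n). (m + n, m)",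
            THEN iffD1, rotated -1]) auto
    have fg: "f m * g (n - m) = r m * s (n - m) * monomial n z" for m n
      using monomial_add[OF zt, of m "n - m"] by (simp add: f_def g_def)
    have summ: "(\<lambda>m. r m * s (n - m)) summable_on UNIV" for n
    proof -
      have "(\<lambda>m. f m * g (n - m)) summable_on UNIV"
        using has_sum_imp_summable[OF prod] by (rule summable_on_SigmaD1) auto
      then show ?thesis
        using monomial_nz[OF zt, of n] by (simp add: fg summable_on_cmult_left')
    qed
    have "((\<lambda>n. series_mult r s n * monomial n z) has_sum F z * G z) UNIV"
    proof (rule has_sum_SigmaD[OF prod])
      show "((\<lambda>m. case (n, m) of (n, m) \<Rightarrow> f m * g (n - m)) has_sum series_mult r s n * monomial n z) UNIV" for n
        using summ[of n] by (auto simp: fg series_mult_def intro!: has_sum_cmult_left)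
    qed
    with summ show ?thesis by blast
  qed
  show "laurent_on U (\<lambda>z. F z * G z) (series_mult r s)"
    using key by (auto simp: laurent_on_def)
  show "(\<lambda>m. r m * s (n - m)) summable_on UNIV" if "U \<noteq> {}"
    using key that by blast
qed

text \<open>The orbit of one point under rotation of the coordinates determines all coefficients:
  they are extracted one variable at a time by \<open>graded_part_eq_0\<close>.\<close>

lemma laurent_on_unique:
  assumes F: "laurent_on U F r" and G: "laurent_on U F s" and z: "z \<in> torus"
    and U: "\<And>u. (\<And>i. norm (u $ i) = 1) \<Longrightarrow> u * z \<in> U"
  shows "r = s"
proof
  fix k :: "int ^ 3"
  \<comment> \<open>The base point is absorbed into the coefficients, so that only unimodular
    variables remain.\<close>
  define a where "a n = (r n - s n) * monomial n z" for n
  have *: "((\<lambda>n. a n * monomial n u) has_sum 0) UNIV" if u: "\<And>i. norm (u $ i) = 1" for u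
  proof -
    have "((\<lambda>n. r n * monomial n (u * z) - s n * monomial n (u * z)) has_sum F (u * z) - F (u * z)) UNIV"
      by (intro has_sum_diff laurent_onD[OF F] laurent_onD[OF G] U u)
    then show ?thesis
      by (simp add: a_def monomial_times algebra_simps)
  qed
  have 0: "((\<lambda>n. a n * u1 powi (n $ 1) * u2 powi (n $ 2) * u3 powi (n $ 3)) has_sum 0) UNIV"
    if "norm u1 = 1" "norm u2 = 1" "norm u3 = 1" for u1 u2 u3
  proof -
    have "norm ((vector [u1, u2, u3] :: complex ^ 3) $ i) = 1" for i
      using that exhaust_3[of i] by auto
    from *[OF this] show ?thesis
      by (simp add: monomial_3 mult.assoc)
  qed
  have part: "(b has_sum 0) {n\<in>A. g n = k}"
    if "\<And>u. norm u = 1 \<Longrightarrow> ((\<lambda>n. b n * u powi g n) has_sum 0) A" for A k and b :: "int ^ 3 \<Rightarrow> complex" and g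
  proof -
    have "b summable_on A"
      using has_sum_imp_summable[OF that[of 1]] by simp
    then have "b summable_on {n\<in>A. g n = k}"
      by (rule summable_on_subset) auto
    with graded_part_eq_0[OF that] show ?thesis
      by (simp add: has_sum_iff)
  qed
  have "((\<lambda>n. a n * u1 powi (n $ 1) * u2 powi (n $ 2)) has_sum 0) {n \<in> UNIV. n $ 3 = k $ 3}"
    if "norm u1 = 1" "norm u2 = 1" for u1 u2
    by (rule part[where g = "\<lambda>n. n $ 3"], rule 0[OF that])
  then have "((\<lambda>n. a n * u1 powi (n $ 1)) has_sum 0) {n \<in> {n \<in> UNIV. n $ 3 = k $ 3}. n $ 2 = k $ 2}"
    if "norm u1 = 1" for u1
    using that by (intro part[where g = "\<lambda>n. n $ 2" and b = "\<lambda>n. a n * u1 powi (n $ 1)"])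
  then have "(a has_sum 0) {n \<in> {n \<in> {n \<in> UNIV. n $ 3 = k $ 3}. n $ 2 = k $ 2}. n $ 1 = k $ 1}"
    by (intro part[where g = "\<lambda>n. n $ 1"])
  also have "{n \<in> {n \<in> {n \<in> UNIV. n $ 3 = k $ 3}. n $ 2 = k $ 2}. n $ 1 = k $ 1} = {k}"
    by (auto simp: vec_eq_iff forall_3)
  finally have "a k = 0"
    by (simp add: has_sum_finite_iff)
  then show "r k = s k"
    using monomial_nz[OF z] by (simp add: a_def)
qed

text \<open>The action of the factor \<open>z $ i - a * z $ j\<close> on coefficients. It is a
  finite combination of shifts, so it applies to formal series before any convergence is
  known.\<close>

definition mult_lin :: "3 \<Rightarrow> complex \<Rightarrow> 3 \<Rightarrow> (int ^ 3 \<Rightarrow> complex) \<Rightarrow> int ^ 3 \<Rightarrow> complex" where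
  "mult_lin i a j r n = r (n - axis i 1) - a * r (n - axis j 1)"

lemma mult_lin_commute: "mult_lin i a j (mult_lin k b l r) = mult_lin k b l (mult_lin i a j r)"
  by (rule ext) (simp add: mult_lin_def algebra_simps)

lemma mult_lin_uminus: "mult_lin i a j (\<lambda>n. - r n) = (\<lambda>n. - mult_lin i a j r n)"
  by (rule ext) (simp add: mult_lin_def)

lemma laurent_on_mult_lin:
  assumes F: "laurent_on U F r" and U: "U \<subseteq> torus"
  shows "laurent_on U (\<lambda>z. (z $ i - a * z $ j) * F z) (mult_lin i a j r)"
  unfolding laurent_on_def
proof
  fix z assume z: "z \<in> U"
  then have zt: "z \<in> torus" using U by blast
  have shift: "((\<lambda>n. r (n - axis i 1) * monomial n z) has_sum z $ i * F z) UNIV" for i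
  proof -
    have "((\<lambda>n. z $ i * (r n * monomial n z)) has_sum z $ i * F z) UNIV"
      by (intro has_sum_cmult_right laurent_onD[OF F z])
    moreover have "((\<lambda>n. z $ i * (r n * monomial n z)) has_sum z $ i * F z) UNIV \<longleftrightarrow>
        ((\<lambda>n. r (n - axis i 1) * monomial n z) has_sum z $ i * F z) UNIV"
      by (rule has_sum_reindex_bij_witness[where i = "\<lambda>n. n - axis i 1" and j = "\<lambda>n. n + axis i 1"])
         (simp_all add: monomial_add[OF zt] monomial_axis)
    ultimately show ?thesis
      by blast
  qed
  have "((\<lambda>n. r (n - axis i 1) * monomial n z - a * (r (n - axis j 1) * monomial n z)) has_sum
      z $ i * F z - a * (z $ j * F z)) UNIV"
    by (intro has_sum_diff has_sum_cmult_right shift)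
  then show "((\<lambda>n. mult_lin i a j r n * monomial n z) has_sum (z $ i - a * z $ j) * F z) UNIV"
    by (simp add: mult_lin_def algebra_simps)
qed

section \<open>Expansions in cones\<close>

text \<open>\<open>(i, j) \<in> R\<close> means \<open>|z\<^sub>i| \<ggreater> |z\<^sub>j|\<close>. Total orders give the regions of the triple products;
  partial orders express that one series is the expansion in several of these regions.\<close>

definition norm_cone :: "(3 \<times> 3) set \<Rightarrow> real \<Rightarrow> (complex ^ 3) set" where
  "norm_cone R \<rho> = {z\<in>torus. \<forall>(i, j)\<in>R. norm (z $ i) > \<rho> * norm (z $ j)}"

definition expands_on :: "(3 \<times> 3) set \<Rightarrow> (complex ^ 3 \<Rightarrow> complex) \<Rightarrow> (int ^ 3 \<Rightarrow> complex) \<Rightarrow> bool" where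
  "expands_on R F r \<longleftrightarrow> (\<exists>\<rho>>0. laurent_on (norm_cone R \<rho>) F r)"

text \<open>The pair \<open>(i, k)\<close> is listed so that any two distinct indices are comparable
  by mere membership, as the lemmas on inverse linear forms require.\<close>

abbreviation chain :: "3 \<Rightarrow> 3 \<Rightarrow> 3 \<Rightarrow> (3 \<times> 3) set" where
  "chain i j k \<equiv> {(i, j), (i, k), (j, k)}"

lemma norm_cone_subset_torus: "norm_cone R \<rho> \<subseteq> torus"
  by (auto simp: norm_cone_def)

lemma norm_cone_antimono: "R \<subseteq> R' \<Longrightarrow> \<rho> \<le> \<rho>' \<Longrightarrow> norm_cone R' \<rho>' \<subseteq> norm_cone R \<rho>"
  unfolding norm_cone_def by (force intro: le_less_trans[OF mult_right_mono])

text \<open>More comparisons cut out a smaller cone. A series found for a partial order is therefore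
  the expansion for every chain refining it; this is what makes the remainder terms cancel in
  pairs.\<close>

lemma expands_on_mono: "expands_on R F r \<Longrightarrow> R \<subseteq> R' \<Longrightarrow> expands_on R' F r"
  unfolding expands_on_def using laurent_on_subset[OF _ norm_cone_antimono] by blast

lemma expands_on_torus: "laurent_on torus F r \<Longrightarrow> expands_on R F r"
  unfolding expands_on_def using laurent_on_subset[OF _ norm_cone_subset_torus] zero_less_one by blast

lemma expands_onE2:
  assumes "expands_on R F r" "expands_on R G s"
  obtains \<rho> where "\<rho> > 0" "laurent_on (norm_cone R \<rho>) F r" "laurent_on (norm_cone R \<rho>) G s"
proof -
  obtain \<rho>1 \<rho>2 where *: "\<rho>1 > 0" "\<rho>2 > 0" "laurent_on (norm_cone R \<rho>1) F r" "laurent_on (norm_cone R \<rho>2) G s"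
    using assms by (auto simp: expands_on_def)
  show thesis
    by (rule that[of "max \<rho>1 \<rho>2"])
       (use * in \<open>auto intro: laurent_on_subset[OF _ norm_cone_antimono[OF order_refl]]\<close>)
qed

lemma expands_on_cong:
  assumes "expands_on R F r" and "\<And>z. z \<in> norm_cone R \<rho>0 \<Longrightarrow> F z = G z"
  shows "expands_on R G r"
proof -
  obtain \<rho> where *: "\<rho> > 0" "laurent_on (norm_cone R \<rho>) F r"
    using assms by (auto simp: expands_on_def)
  have "laurent_on (norm_cone R (max \<rho> \<rho>0)) G r"
  proof (rule laurent_on_cong)
    show "laurent_on (norm_cone R (max \<rho> \<rho>0)) F r"
      using *(2) by (rule laurent_on_subset[OF _ norm_cone_antimono[OF order_refl]]) simp
    show "F z = G z" if "z \<in> norm_cone R (max \<rho> \<rho>0)" for z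
      using that norm_cone_antimono[of R R \<rho>0 "max \<rho> \<rho>0"] by (intro assms) auto
  qed
  then show ?thesis
    unfolding expands_on_def using *(1) by (auto intro!: exI[of _ "max \<rho> \<rho>0"])
qed

lemma expands_on_add:
  assumes "expands_on R F r" "expands_on R G s"
  shows "expands_on R (\<lambda>z. F z + G z) (\<lambda>n. r n + s n)"
  using expands_onE2[OF assms] unfolding expands_on_def
  by (metis laurent_on_add)

lemma expands_on_scale: "expands_on R F r \<Longrightarrow> expands_on R (\<lambda>z. k * F z) (\<lambda>n. k * r n)"
  by (auto simp: expands_on_def intro: laurent_on_scale)

lemma expands_on_mult:
  assumes "expands_on R F r" "expands_on R G s"
  shows "expands_on R (\<lambda>z. F z * G z) (series_mult r s)"
  using expands_onE2[OF assms] unfolding expands_on_def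
  by (metis laurent_on_mult(1) norm_cone_subset_torus)

lemma region_eq_cone: "region i j k \<rho> = norm_cone {(i, j), (j, k)} \<rho>"
  by (auto simp: region_def norm_cone_def)

lemma region_subset_cone:
  assumes "\<rho> \<ge> 1"
  shows "region i j k \<rho> \<subseteq> norm_cone (chain i j k) \<rho>"
proof
  fix z assume z: "z \<in> region i j k \<rho>"
  have "\<rho> * norm (z $ k) < norm (z $ j)" "\<rho> * norm (z $ j) < norm (z $ i)"
    using z by (auto simp: region_def)
  moreover have "norm (z $ j) \<le> \<rho> * norm (z $ j)"
    using mult_right_mono[OF assms, of "norm (z $ j)"] by simp
  ultimately show "z \<in> norm_cone (chain i j k) \<rho>"
    using z by (auto simp: norm_cone_def region_def)
qed

text \<open>Once the radius is at least 1, the comparison of \<open>i\<close> with \<open>k\<close>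
  follows by transitivity from the other two, and the radius may always be enlarged.\<close>

lemma expands_in_iff: "expands_in i j k F r \<longleftrightarrow> expands_on (chain i j k) F r"
proof
  assume "expands_in i j k F r"
  then have "expands_on {(i, j), (j, k)} F r"
    by (simp add: expands_in_def expands_on_def laurent_on_def region_eq_cone)
  then show "expands_on (chain i j k) F r"
    by (rule expands_on_mono) auto
next
  assume "expands_on (chain i j k) F r"
  then obtain \<rho> where *: "\<rho> > 0" "laurent_on (norm_cone (chain i j k) \<rho>) F r"
    by (auto simp: expands_on_def)
  have "region i j k (max 1 \<rho>) \<subseteq> norm_cone (chain i j k) (max 1 \<rho>)"
    by (rule region_subset_cone) simp
  also have "\<dots> \<subseteq> norm_cone (chain i j k) \<rho>"
    by (rule norm_cone_antimono) auto
  finally have "laurent_on (region i j k (max 1 \<rho>)) F r"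
    using *(2) laurent_on_subset by blast
  then show "expands_in i j k F r"
    by (auto simp: expands_in_def laurent_on_def intro!: exI[of _ "max 1 \<rho>"])
qed

lemma expands_on_chain_unique:
  assumes "expands_on (chain i j k) F r" "expands_on (chain i j k) F s"
    and distinct: "i \<noteq> j" "j \<noteq> k" "i \<noteq> k"
  shows "r = s"
  using assms(1,2)
proof (rule expands_onE2)
  fix \<rho> :: real
  assume \<rho>: "\<rho> > 0" and F: "laurent_on (norm_cone (chain i j k) \<rho>) F r" "laurent_on (norm_cone (chain i j k) \<rho>) F s"
  \<comment> \<open>The coordinates \<open>t ^ 2\<close>, \<open>t\<close>, \<open>1\<close> with
    \<open>t > \<rho>\<close> and \<open>t > 1\<close> satisfy all three comparisons, and these
    depend on absolute values only, so the whole orbit lies in the cone.\<close>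
  define t where "t = \<rho> + 1"
  define z :: "complex ^ 3" where
    "z = (\<chi> l. of_real (if l = i then t ^ 2 else if l = j then t else 1))"
  have t: "t > 1" "\<rho> < t" using \<rho> by (auto simp: t_def)
  show "r = s"
  proof (rule laurent_on_unique[OF F])
    show "z \<in> torus"
      using t by (auto simp: z_def torus_def)
    have "\<rho> * t < t ^ 2"
      using t by (simp add: power2_eq_square)
    have "\<rho> < t ^ 2"
      using t \<rho> by (smt (verit) mult_less_cancel_right1 power2_eq_square)
    show "u * z \<in> norm_cone (chain i j k) \<rho>" if u: "\<And>i. norm (u $ i) = 1" for u
    proof -
      have N: "norm ((u * z) $ l) = (if l = i then t ^ 2 else if l = j then t else 1)" for l
        using u t by (simp add: z_def norm_mult norm_power)
      have "norm ((u * z) $ l) > 0" for l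
        using t by (simp only: N) simp
      then have "u * z \<in> torus"
        unfolding torus_def zero_less_norm_iff by simp
      with \<open>\<rho> * t < t ^ 2\<close> \<open>\<rho> < t ^ 2\<close> t distinct show ?thesis
        unfolding norm_cone_def by (simp add: N del: vector_mult_component)
    qed
  qed
qed

lemma expansion_eqI:
  assumes "expands_on (chain i j k) F r" and "i \<noteq> j" "j \<noteq> k" "i \<noteq> k"
  shows "expansion i j k F = r"
  unfolding expansion_def expands_in_iff using assms expands_on_chain_unique by blast

section \<open>Expansions of inverse linear forms\<close>

lemma monomial_two:
  assumes "i \<noteq> j"
  shows "monomial (\<chi> l. if l = j then b else if l = i then c else 0) z = z $ j powi b * z $ i powi c"
proof -
  have "monomial (\<chi> l. if l = j then b else if l = i then c else 0) z =
      (\<Prod>l\<in>UNIV. (if l = j then z $ j powi b else 1) * (if l = i then z $ i powi c else 1))"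
    unfolding monomial_def using assms by (intro prod.cong) auto
  then show ?thesis
    by (simp add: prod.distrib)
qed

lemma laurent_on_inverse_lin:
  assumes "i \<noteq> j"
  shows "\<exists>r. laurent_on (norm_cone {(i, j)} (norm a)) (\<lambda>z. inverse (z $ i - a * z $ j)) r"
proof -
  \<comment> \<open>\<open>p m\<close> is the exponent of the \<open>m\<close>-th term
    \<open>a ^ m * z_j ^ m / z_i ^ (m + 1)\<close> of the geometric series.\<close>
  define p :: "nat \<Rightarrow> int ^ 3" where "p m = (\<chi> l. if l = j then int m else if l = i then - int (Suc m) else 0)" for m
  define r where "r n = (if n \<in> range p then a ^ nat (n $ j) else 0)" for n
  have inj: "inj p"
    by (auto simp: inj_on_def p_def vec_eq_iff split: if_splits)
  have "((\<lambda>n. r n * monomial n z) has_sum inverse (z $ i - a * z $ j)) UNIV"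
    if z: "z \<in> norm_cone {(i, j)} (norm a)" for z
  proof -
    have z0: "z $ i \<noteq> 0" "z $ j \<noteq> 0" and less: "norm (a * z $ j / z $ i) < 1"
      using z by (auto simp: norm_cone_def torus_def norm_mult norm_divide divide_less_eq)
    have "(\<lambda>m. (a * z $ j / z $ i) ^ m) sums (1 / (1 - a * z $ j / z $ i))"
      by (rule geometric_sums[OF less])
    moreover have "summable (\<lambda>m. norm ((a * z $ j / z $ i) ^ m))"
      using less by (simp add: norm_power summable_geometric)
    ultimately have "((\<lambda>m. (a * z $ j / z $ i) ^ m) has_sum (1 / (1 - a * z $ j / z $ i))) UNIV"
      by (intro norm_summable_imp_has_sum)
    then have "((\<lambda>m. inverse (z $ i) * (a * z $ j / z $ i) ^ m) has_sum
        inverse (z $ i) * (1 / (1 - a * z $ j / z $ i))) UNIV"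
      by (rule has_sum_cmult_right)
    also have "inverse (z $ i) * (1 / (1 - a * z $ j / z $ i)) = inverse (z $ i - a * z $ j)"
      using z0 by (simp add: field_simps)
    also have "(\<lambda>m. inverse (z $ i) * (a * z $ j / z $ i) ^ m) = (\<lambda>n. r n * monomial n z) \<circ> p"
    proof
      fix m
      have "p m $ j = int m" by (simp add: p_def)
      moreover have "monomial (p m) z = z $ j ^ m * inverse (z $ i ^ Suc m)"
        unfolding p_def monomial_two[OF assms] power_int_minus power_int_of_nat ..
      ultimately show "inverse (z $ i) * (a * z $ j / z $ i) ^ m = ((\<lambda>n. r n * monomial n z) \<circ> p) m"
        by (simp add: r_def power_mult_distrib power_divide field_simps)
    qed
    finally have "((\<lambda>n. r n * monomial n z) has_sum inverse (z $ i - a * z $ j)) (range p)"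
      using has_sum_reindex[OF inj] by blast
    then show ?thesis
      by (subst has_sum_cong_neutral[where T = "range p" and g = "\<lambda>n. r n * monomial n z"])
         (auto simp: r_def)
  qed
  then show ?thesis
    by (auto simp: laurent_on_def)
qed

text \<open>Forgets the coefficients: for rational factors other than the kernel only the existence
  of an expansion matters.\<close>

definition expandable :: "(3 \<times> 3) set \<Rightarrow> (complex ^ 3 \<Rightarrow> complex) \<Rightarrow> bool" where
  "expandable R F \<longleftrightarrow> (\<exists>r. expands_on R F r)"

lemma expandable_mult [intro]: "expandable R F \<Longrightarrow> expandable R G \<Longrightarrow> expandable R (\<lambda>z. F z * G z)"
  using expands_on_mult by (fastforce simp: expandable_def)

lemma expandable_add [intro]: "expandable R F \<Longrightarrow> expandable R G \<Longrightarrow> expandable R (\<lambda>z. F z + G z)"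
  using expands_on_add by (fastforce simp: expandable_def)

lemma expandable_coordinate [intro]: "expandable R (\<lambda>z. z $ i)"
  using expands_on_torus[OF laurent_on_coordinate] by (auto simp: expandable_def)

lemma expandable_scale [intro]: "expandable R F \<Longrightarrow> expandable R (\<lambda>z. k * F z)"
  using expands_on_scale by (fastforce simp: expandable_def)

lemma expandable_lin [intro]: "expandable R (\<lambda>z. z $ i - a * z $ j)"
  using expandable_add[OF expandable_coordinate[of R i] expandable_scale[OF expandable_coordinate[of R j], of "- a"]]
  by simp

lemma expandable_inverse_lin1:
  assumes "(i, j) \<in> R" "i \<noteq> j"
  shows "expandable R (\<lambda>z. inverse (z $ i - a * z $ j))"
proof -
  obtain r where "laurent_on (norm_cone {(i, j)} (norm a)) (\<lambda>z. inverse (z $ i - a * z $ j)) r"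
    using laurent_on_inverse_lin[OF assms(2)] by blast
  then have "laurent_on (norm_cone R (norm a + 1)) (\<lambda>z. inverse (z $ i - a * z $ j)) r"
    by (rule laurent_on_subset[OF _ norm_cone_antimono]) (use assms in auto)
  moreover have "norm a + 1 > 0" using norm_ge_zero[of a] by linarith
  ultimately show ?thesis
    unfolding expandable_def expands_on_def by blast
qed

text \<open>If \<open>z $ j\<close> dominates, the factor \<open>- a\<close> is pulled out and the
  form is expanded in the other direction; hence \<open>a \<noteq> 0\<close>.\<close>

lemma expandable_inverse_lin:
  assumes "(i, j) \<in> R \<or> (j, i) \<in> R" "i \<noteq> j" "a \<noteq> 0"
  shows "expandable R (\<lambda>z. inverse (z $ i - a * z $ j))"
  using assms(1)
proof
  assume "(j, i) \<in> R"
  then have "expandable R (\<lambda>z. - inverse a * inverse (z $ j - inverse a * z $ i))"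
    using assms by (intro expandable_scale expandable_inverse_lin1) auto
  moreover have "- inverse a * inverse (z $ j - inverse a * z $ i) = inverse (z $ i - a * z $ j)" for z
  proof -
    have "- inverse a * inverse (z $ j - inverse a * z $ i) = inverse (- a * (z $ j - inverse a * z $ i))"
      by (simp add: inverse_mult_distrib)
    also have "- a * (z $ j - inverse a * z $ i) = z $ i - a * z $ j"
      using assms by (simp add: field_simps)
    finally show ?thesis .
  qed
  ultimately show ?thesis by simp
qed (use assms expandable_inverse_lin1 in blast)

lemma norm_cone_lin_nz:
  assumes "z \<in> norm_cone R \<rho>" "(i, j) \<in> R" "norm a \<le> \<rho>"
  shows "z $ i - a * z $ j \<noteq> 0"
proof
  assume "z $ i - a * z $ j = 0"
  then have "norm (z $ i) = norm a * norm (z $ j)"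
    by (simp add: norm_mult)
  moreover have "norm a * norm (z $ j) \<le> \<rho> * norm (z $ j)"
    using assms by (intro mult_right_mono) auto
  ultimately show False
    using assms(1,2) by (auto simp: norm_cone_def)
qed

section \<open>The two-sided geometric series and the kernel\<close>

lemma has_sum_geometric_nonneg:
  assumes "norm (w :: complex) < 1"
  shows "((\<lambda>k::int. w powi k) has_sum 1 / (1 - w)) {0..}"
proof -
  have "(\<lambda>m. w ^ m) sums (1 / (1 - w))"
    by (rule geometric_sums[OF assms])
  moreover have "summable (\<lambda>m. norm (w ^ m))"
    using assms by (simp add: norm_power summable_geometric)
  ultimately have "((\<lambda>m. w ^ m) has_sum (1 / (1 - w))) UNIV"
    by (intro norm_summable_imp_has_sum)
  then show ?thesis
    by (rule has_sum_reindex_bij_witness[where i = nat and j = int, THEN iffD1, rotated -1]) auto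
qed

text \<open>The minus sign is the origin of the delta functions: the expansions of
  \<open>1 / (1 - w)\<close> for small and for large \<open>w\<close> differ by the full series of
  all integer powers.\<close>

lemma has_sum_geometric_neg:
  assumes "norm (w :: complex) > 1"
  shows "((\<lambda>k::int. w powi k) has_sum - (1 / (1 - w))) {..<0}"
proof -
  have w: "w \<noteq> 0" "w \<noteq> 1" using assms by auto
  have "norm (inverse w) < 1"
    using assms by (simp add: norm_inverse inverse_less_1_iff)
  then have "((\<lambda>k::int. inverse w * inverse w powi k) has_sum inverse w * (1 / (1 - inverse w))) {0..}"
    by (intro has_sum_cmult_right has_sum_geometric_nonneg)
  also have "inverse w * (1 / (1 - inverse w)) = - (1 / (1 - w))"
    using w by (simp add: field_simps)
  finally have 1: "((\<lambda>k::int. inverse w * inverse w powi k) has_sum - (1 / (1 - w))) {0..}" .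
  have "w powi (- 1 - k) = inverse w * inverse w powi k" for k
    using w by (simp add: power_int_diff power_int_minus power_int_inverse divide_inverse)
  then have "((\<lambda>k::int. inverse w * inverse w powi k) has_sum - (1 / (1 - w))) {0..} \<longleftrightarrow>
      ((\<lambda>k::int. w powi k) has_sum - (1 / (1 - w))) {..<0}"
    by (intro has_sum_reindex_bij_witness[where i = "\<lambda>k. - 1 - k" and j = "\<lambda>k. - 1 - k"]) auto
  with 1 show ?thesis by blast
qed

text \<open>The expansions of \<open>1 / (z\<^sub>1\<^sup>2 (z\<^sub>3 - a z\<^sub>1) (z\<^sub>1 - b z\<^sub>2))\<close>: \<open>K\<close> and \<open>L\<close> are the ranges of the
  exponents of \<open>a z\<^sub>1 / z\<^sub>3\<close> and \<open>b z\<^sub>2 / z\<^sub>1\<close>, which are either the nonnegative or the negative integers.\<close>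

definition geom2 :: "complex \<Rightarrow> complex \<Rightarrow> int set \<Rightarrow> int set \<Rightarrow> int ^ 3 \<Rightarrow> complex" where
  "geom2 a b K L n =
     (if n $ 1 + n $ 2 + n $ 3 = -4 \<and> - n $ 3 - 1 \<in> K \<and> n $ 2 \<in> L
      then a powi (- n $ 3 - 1) * b powi (n $ 2) else 0)"

lemma geom2_has_sum:
  assumes z: "z \<in> torus"
    and A: "((\<lambda>k. (a * z $ 1 / z $ 3) powi k) has_sum A) K"
    and B: "((\<lambda>l. (b * z $ 2 / z $ 1) powi l) has_sum B) L"
  shows "((\<lambda>n. geom2 a b K L n * monomial n z) has_sum A * B / (z $ 1 ^ 3 * z $ 3)) UNIV"
proof -
  \<comment> \<open>The prefactor \<open>1 / (z_1 ^ 3 * z_3)\<close> shifts the exponents to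
    \<open>(k - l - 3, l, - k - 1)\<close>. Their sum is always -4, and
    \<open>k = - n_3 - 1\<close>, \<open>l = n_2\<close> recover the pair.\<close>
  define p :: "int \<times> int \<Rightarrow> int ^ 3" where "p = (\<lambda>(k, l). vector [k - l - 3, l, - k - 1])"
  have z0: "z $ 1 \<noteq> 0" "z $ 2 \<noteq> 0" "z $ 3 \<noteq> 0"
    using z by (auto simp: torus_3)
  have inj: "inj_on p (K \<times> L)"
    by (auto simp: inj_on_def p_def vec_eq_iff forall_3)
  have "((\<lambda>x. (case x of (k, l) \<Rightarrow> (a * z $ 1 / z $ 3) powi k * (b * z $ 2 / z $ 1) powi l) *
      inverse (z $ 1 ^ 3 * z $ 3)) has_sum A * B * inverse (z $ 1 ^ 3 * z $ 3)) (K \<times> L)"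
    by (intro has_sum_cmult_left has_sum_Times_mult A B)
  moreover have "(case x of (k, l) \<Rightarrow> (a * z $ 1 / z $ 3) powi k * (b * z $ 2 / z $ 1) powi l) *
      inverse (z $ 1 ^ 3 * z $ 3) = ((\<lambda>n. geom2 a b K L n * monomial n z) \<circ> p) x"
    if x: "x \<in> K \<times> L" for x
  proof -
    obtain k l where kl: "x = (k, l)" "k \<in> K" "l \<in> L" using x by auto
    have "monomial (p x) z = z $ 1 powi k * inverse (z $ 1 powi l) * inverse (z $ 1 ^ 3) * z $ 2 powi l *
        (inverse (z $ 3 powi k) * inverse (z $ 3))"
      using z0 by (simp add: kl p_def monomial_3 power_int_diff power_int_minus divide_inverse)
    moreover have "geom2 a b K L (p x) = a powi k * b powi l"
      using kl by (simp add: geom2_def p_def)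
    ultimately show ?thesis
      by (simp add: kl(1) power_int_mult_distrib power_int_divide_distrib divide_inverse power_int_inverse mult_ac)
  qed
  ultimately have "(((\<lambda>n. geom2 a b K L n * monomial n z) \<circ> p) has_sum A * B / (z $ 1 ^ 3 * z $ 3)) (K \<times> L)"
    unfolding divide_inverse by (simp cong: has_sum_cong)
  then have img: "((\<lambda>n. geom2 a b K L n * monomial n z) has_sum A * B / (z $ 1 ^ 3 * z $ 3)) (p ` (K \<times> L))"
    using has_sum_reindex[OF inj] by blast
  have "geom2 a b K L n = 0" if "n \<notin> p ` (K \<times> L)" for n
  proof (rule ccontr)
    assume "geom2 a b K L n \<noteq> 0"
    then have "n $ 1 + n $ 2 + n $ 3 = -4" "- n $ 3 - 1 \<in> K" "n $ 2 \<in> L"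
      by (auto simp: geom2_def split: if_splits)
    then have "n = p (- n $ 3 - 1, n $ 2)" "(- n $ 3 - 1, n $ 2) \<in> K \<times> L"
      by (auto simp: p_def vec_eq_iff forall_3)
    with that show False by blast
  qed
  with img show ?thesis
    by (subst has_sum_cong_neutral[where T = "p ` (K \<times> L)" and g = "\<lambda>n. geom2 a b K L n * monomial n z"]) auto
qed

lemma norm_cone_has_sum_geometric:
  assumes z: "z \<in> norm_cone R \<rho>" and a: "norm a \<le> \<rho>" "norm (inverse a) \<le> \<rho>" "a \<noteq> 0"
  shows "(i, j) \<in> R \<Longrightarrow>
      ((\<lambda>k. (a * z $ j / z $ i) powi k) has_sum z $ i * inverse (z $ i - a * z $ j)) {0..}"
    and "(j, i) \<in> R \<Longrightarrow>
      ((\<lambda>k. (a * z $ j / z $ i) powi k) has_sum - (z $ i * inverse (z $ i - a * z $ j))) {..<0}"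
proof -
  have z0: "z $ l \<noteq> 0" for l
    using z by (auto simp: norm_cone_def torus_def)
  have eq: "1 / (1 - a * z $ j / z $ i) = z $ i * inverse (z $ i - a * z $ j)"
    using z0 by (simp add: divide_simps)
  show "((\<lambda>k. (a * z $ j / z $ i) powi k) has_sum z $ i * inverse (z $ i - a * z $ j)) {0..}"
    if "(i, j) \<in> R"
  proof -
    have "norm a * norm (z $ j) \<le> \<rho> * norm (z $ j)"
      using a by (intro mult_right_mono) auto
    also have "\<dots> < norm (z $ i)"
      using z that by (auto simp: norm_cone_def)
    finally show ?thesis
      using has_sum_geometric_nonneg[of "a * z $ j / z $ i"] z0[of i] unfolding eq
      by (simp add: norm_mult norm_divide divide_less_eq)
  qed
  show "((\<lambda>k. (a * z $ j / z $ i) powi k) has_sum - (z $ i * inverse (z $ i - a * z $ j))) {..<0}"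
    if "(j, i) \<in> R"
  proof -
    have "norm (inverse a) * norm (z $ i) \<le> \<rho> * norm (z $ i)"
      using a by (intro mult_right_mono) auto
    also have "\<dots> < norm (z $ j)"
      using z that by (auto simp: norm_cone_def)
    finally have "norm (z $ i) < norm a * norm (z $ j)"
      using a(3) by (simp add: norm_inverse pos_divide_less_eq divide_inverse_commute[symmetric] mult.commute)
    then show ?thesis
      using has_sum_geometric_neg[of "a * z $ j / z $ i"] z0[of i] unfolding eq
      by (simp add: norm_mult norm_divide less_divide_eq)
  qed
qed

text \<open>One term of the partial fraction decomposition of the kernel in \<open>z $ 3\<close>;
  the factor \<open>inverse (z $ 1) ^ 2\<close> is produced by that decomposition and makes the
  total degree -4.\<close>

definition kernel2 :: "complex \<Rightarrow> complex \<Rightarrow> complex ^ 3 \<Rightarrow> complex" where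
  "kernel2 a b z = inverse (z $ 1) ^ 2 * inverse (z $ 3 - a * z $ 1) * inverse (z $ 1 - b * z $ 2)"

text \<open>Only the comparisons of 3 with 1 and of 1 with 2 matter. Reversing one of them replaces
  nonnegative by negative exponents and contributes a sign. The four quadrants of exponents tile the
  integer plane, so with these signs the four expansions add up to a product of two deltas.\<close>

lemma geom2_expands_on:
  assumes "a \<noteq> 0" "b \<noteq> 0"
  shows "expands_on (chain 3 1 2) (kernel2 a b) (geom2 a b {0..} {0..})"
    and "expands_on (chain 3 2 1) (\<lambda>z. - kernel2 a b z) (geom2 a b {0..} {..<0})"
    and "expands_on (chain 1 2 3) (\<lambda>z. - kernel2 a b z) (geom2 a b {..<0} {0..})"
    and "expands_on (chain 2 1 3) (kernel2 a b) (geom2 a b {..<0} {..<0})"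
proof -
  define \<rho> where "\<rho> = Max {1, norm a, norm (inverse a), norm b, norm (inverse b)}"
  have \<rho>: "1 \<le> \<rho>" "norm a \<le> \<rho>" "norm (inverse a) \<le> \<rho>" "norm b \<le> \<rho>" "norm (inverse b) \<le> \<rho>"
    unfolding \<rho>_def by (intro Max_ge; simp)+
  have eq: "s * (z $ 3 * inverse (z $ 3 - a * z $ 1)) * (t * (z $ 1 * inverse (z $ 1 - b * z $ 2))) /
      (z $ 1 ^ 3 * z $ 3) = (s * t) * kernel2 a b z" if "z \<in> torus" for z and s t :: complex
  proof -
    have general: "s * (y * A) * (t * (x * B)) / (x ^ 3 * y) = s * t * (inverse x ^ 2 * A * B)"
      if "x \<noteq> 0" "y \<noteq> 0" for x y A B :: complex
      using that by (simp add: field_simps power2_eq_square power3_eq_cube)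
    show ?thesis
      unfolding kernel2_def using that by (intro general) (auto simp: torus_3)
  qed
  have *: "expands_on R (\<lambda>z. (s * t) * kernel2 a b z) (geom2 a b K L)"
    if "\<And>z. z \<in> norm_cone R \<rho> \<Longrightarrow>
          ((\<lambda>k. (a * z $ 1 / z $ 3) powi k) has_sum s * (z $ 3 * inverse (z $ 3 - a * z $ 1))) K"
      and "\<And>z. z \<in> norm_cone R \<rho> \<Longrightarrow>
          ((\<lambda>k. (b * z $ 2 / z $ 1) powi k) has_sum t * (z $ 1 * inverse (z $ 1 - b * z $ 2))) L"
    for R s t K L
    unfolding expands_on_def laurent_on_def
  proof (intro exI[of _ \<rho>] conjI ballI)
    show "\<rho> > 0" using \<rho>(1) by simp
    fix z assume z: "z \<in> norm_cone R \<rho>"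
    then have zt: "z \<in> torus" using norm_cone_subset_torus by blast
    show "((\<lambda>n. geom2 a b K L n * monomial n z) has_sum s * t * kernel2 a b z) UNIV"
      unfolding eq[OF zt, symmetric] by (rule geom2_has_sum[OF zt that[OF z]])
  qed
  note geo = norm_cone_has_sum_geometric[OF _ \<rho>(2,3) assms(1), where i = 3 and j = 1]
    norm_cone_has_sum_geometric[OF _ \<rho>(4,5) assms(2), where i = 1 and j = 2]
  show "expands_on (chain 3 1 2) (kernel2 a b) (geom2 a b {0..} {0..})"
    using *[where R = "chain 3 1 2" and s = "1" and K = "{0..}" and t = "1" and L = "{0..}"] geo by simp
  show "expands_on (chain 3 2 1) (\<lambda>z. - kernel2 a b z) (geom2 a b {0..} {..<0})"
    using *[where R = "chain 3 2 1" and s = "1" and K = "{0..}" and t = "-1" and L = "{..<0}"] geo by simp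
  show "expands_on (chain 1 2 3) (\<lambda>z. - kernel2 a b z) (geom2 a b {..<0} {0..})"
    using *[where R = "chain 1 2 3" and s = "-1" and K = "{..<0}" and t = "1" and L = "{0..}"] geo by simp
  show "expands_on (chain 2 1 3) (kernel2 a b) (geom2 a b {..<0} {..<0})"
    using *[where R = "chain 2 1 3" and s = "-1" and K = "{..<0}" and t = "-1" and L = "{..<0}"] geo by simp
qed

section \<open>The quadratic relations\<close>

definition vandermonde :: "complex ^ 3 \<Rightarrow> complex" where
  "vandermonde z = (z $ 1 - z $ 2) * (z $ 1 - z $ 3) * (z $ 2 - z $ 3)"

definition vec3_perm :: "3 \<Rightarrow> 3 \<Rightarrow> 3 \<Rightarrow> 'c ^ 3 \<Rightarrow> 'c ^ 3" where
  "vec3_perm i j k n = (\<chi> l. if l = 1 then n $ i else if l = 2 then n $ j else n $ k)"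

lemma vec3_perm_nth [simp]:
  "vec3_perm i j k n $ 1 = n $ i" "vec3_perm i j k n $ 2 = n $ j" "vec3_perm i j k n $ 3 = n $ k"
  by (simp_all add: vec3_perm_def)

text \<open>\<open>t a b c\<close> will be the matrix coefficient
  \<open>f (x a (x b (x c v)))\<close>. The quadratic relation enters twice: for the two left
  currents, applied to the vector \<open>x c v\<close>, and for the two right ones, tested against
  \<open>f \<circ> x a\<close>.\<close>

locale exchange_relations =
  fixes p1 p2 :: complex and t :: "int \<Rightarrow> int \<Rightarrow> int \<Rightarrow> complex" and Y :: "complex ^ 3 \<Rightarrow> complex"
  assumes exchange12:
      "t (m + 2) n k - (p1 + p2) * t (m + 1) (n + 1) k + p1 * p2 * t m (n + 2) k =
       - (p1 * p2 * t n (m + 2) k - (p1 + p2) * t (n + 1) (m + 1) k + t (n + 2) m k)"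
    and exchange23:
      "t k (m + 2) n - (p1 + p2) * t k (m + 1) (n + 1) + p1 * p2 * t k m (n + 2) =
       - (p1 * p2 * t k n (m + 2) - (p1 + p2) * t k (n + 1) (m + 1) + t k (n + 2) m)"
    and holomorphic_Y: "holomorphic_on_torus Y"
    and expands_Y: "expands_in 1 2 3 (\<lambda>z. Y z / Y_factor p1 p2 z) (\<lambda>n. t (- (n $ 1)) (- (n $ 2)) (- (n $ 3)))"
begin

definition word :: "3 \<Rightarrow> 3 \<Rightarrow> 3 \<Rightarrow> int ^ 3 \<Rightarrow> complex" where
  "word i j k n = t (- (n $ i)) (- (n $ j)) (- (n $ k))"

definition quad :: "3 \<Rightarrow> 3 \<Rightarrow> (int ^ 3 \<Rightarrow> complex) \<Rightarrow> int ^ 3 \<Rightarrow> complex" where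
  "quad i j r = mult_lin i p1 j (mult_lin i p2 j r)"

definition quad_poly :: "3 \<Rightarrow> 3 \<Rightarrow> complex ^ 3 \<Rightarrow> complex" where
  "quad_poly i j z = (z $ i - p1 * z $ j) * (z $ i - p2 * z $ j)"

definition cleared :: "3 \<Rightarrow> 3 \<Rightarrow> 3 \<Rightarrow> int ^ 3 \<Rightarrow> complex" where
  "cleared i j k = quad i j (quad i k (quad j k (word i j k)))"

definition denom :: "3 \<Rightarrow> 3 \<Rightarrow> 3 \<Rightarrow> complex ^ 3 \<Rightarrow> complex" where
  "denom i j k z = quad_poly i j z * quad_poly i k z * quad_poly j k z"

lemma quad_commute: "quad i j (quad k l r) = quad k l (quad i j r)"
  unfolding quad_def by (metis mult_lin_commute)

lemma quad_uminus: "quad i j (\<lambda>n. - r n) = (\<lambda>n. - quad i j r n)"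
  unfolding quad_def by (simp add: mult_lin_uminus)

lemma laurent_on_quad:
  "laurent_on U F r \<Longrightarrow> U \<subseteq> torus \<Longrightarrow> laurent_on U (\<lambda>z. quad_poly i j z * F z) (quad i j r)"
  unfolding quad_def quad_poly_def mult.assoc by (intro laurent_on_mult_lin)

text \<open>Since \<open>(z p_1 - w)(z p_2 - w) = (w - p_1 z)(w - p_2 z)\<close>, both sides of the
  quadratic relation carry the factor belonging to their own order of variables, and exchanging the
  currents only changes the sign.\<close>

lemma quad_word12:
  assumes "i \<noteq> j" "j \<noteq> k" "i \<noteq> k"
  shows "quad j i (word j i k) = (\<lambda>n. - quad i j (word i j k) n)"
proof
  fix n :: "int ^ 3"
  have "quad i j (word i j k) n =
      t (- (n $ i) + 2) (- (n $ j)) (- (n $ k)) - (p1 + p2) * t (- (n $ i) + 1) (- (n $ j) + 1) (- (n $ k)) +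
      p1 * p2 * t (- (n $ i)) (- (n $ j) + 2) (- (n $ k))"
    using assms by (simp add: quad_def mult_lin_def word_def axis_def algebra_simps)
  moreover have "quad j i (word j i k) n =
      p1 * p2 * t (- (n $ j)) (- (n $ i) + 2) (- (n $ k)) -
      (p1 + p2) * t (- (n $ j) + 1) (- (n $ i) + 1) (- (n $ k)) +
      t (- (n $ j) + 2) (- (n $ i)) (- (n $ k))"
    using assms by (simp add: quad_def mult_lin_def word_def axis_def algebra_simps)
  ultimately show "quad j i (word j i k) n = - quad i j (word i j k) n"
    using exchange12[of "- (n $ i)" "- (n $ j)" "- (n $ k)"] by simp
qed

lemma quad_word23:
  assumes "i \<noteq> j" "j \<noteq> k" "i \<noteq> k"
  shows "quad k j (word i k j) = (\<lambda>n. - quad j k (word i j k) n)"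
proof
  fix n :: "int ^ 3"
  have "quad j k (word i j k) n =
      t (- (n $ i)) (- (n $ j) + 2) (- (n $ k)) - (p1 + p2) * t (- (n $ i)) (- (n $ j) + 1) (- (n $ k) + 1) +
      p1 * p2 * t (- (n $ i)) (- (n $ j)) (- (n $ k) + 2)"
    using assms by (simp add: quad_def mult_lin_def word_def axis_def algebra_simps)
  moreover have "quad k j (word i k j) n =
      p1 * p2 * t (- (n $ i)) (- (n $ k)) (- (n $ j) + 2) -
      (p1 + p2) * t (- (n $ i)) (- (n $ k) + 1) (- (n $ j) + 1) +
      t (- (n $ i)) (- (n $ k) + 2) (- (n $ j))"
    using assms by (simp add: quad_def mult_lin_def word_def axis_def algebra_simps)
  ultimately show "quad k j (word i k j) n = - quad j k (word i j k) n"
    using exchange23[of "- (n $ i)" "- (n $ j)" "- (n $ k)"] by simp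
qed

text \<open>The factor for the exchanged pair is commuted next to the word; the other two factors
  are merely permuted by the exchange.\<close>

lemma cleared_swap12:
  assumes "i \<noteq> j" "j \<noteq> k" "i \<noteq> k"
  shows "cleared j i k = (\<lambda>n. - cleared i j k n)"
proof -
  have "cleared j i k = quad i k (quad j k (quad j i (word j i k)))"
    by (simp only: cleared_def quad_commute[of j i j k] quad_commute[of j i i k] quad_commute[of j k i k])
  also have "\<dots> = (\<lambda>n. - quad i k (quad j k (quad i j (word i j k))) n)"
    by (simp only: quad_word12[OF assms] quad_uminus)
  also have "quad i k (quad j k (quad i j (word i j k))) = cleared i j k"
    by (simp only: cleared_def quad_commute[of i j i k] quad_commute[of i j j k])
  finally show ?thesis .
qed

lemma cleared_swap23:
  assumes "i \<noteq> j" "j \<noteq> k" "i \<noteq> k"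
  shows "cleared i k j = (\<lambda>n. - cleared i j k n)"
  by (simp only: cleared_def quad_word23[OF assms] quad_uminus quad_commute[of i k i j])

lemma cleared_signs:
  "cleared 2 1 3 = (\<lambda>n. - cleared 1 2 3 n)"
  "cleared 3 1 2 = cleared 1 2 3"
  "cleared 3 2 1 = (\<lambda>n. - cleared 1 2 3 n)"
  using cleared_swap12[of 1 2 3] cleared_swap23[of 1 2 3] cleared_swap12[of 1 3 2] cleared_swap23[of 3 1 2]
  by simp_all

text \<open>The words in different orders differ by a renaming of variables, applied to exponents
  and points alike, so the one hypothesis on the order 1, 2, 3 yields convergence in all six regions
  with a common radius. At this stage the six sums are unrelated functions.\<close>

lemma laurent_on_word:
  obtains \<rho> G where "\<rho> \<ge> 1" "norm p1 \<le> \<rho>" "norm p2 \<le> \<rho>"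
    "G 1 2 3 = (\<lambda>z. Y z / Y_factor p1 p2 z)"
    "\<And>i j k. i \<noteq> j \<Longrightarrow> j \<noteq> k \<Longrightarrow> i \<noteq> k \<Longrightarrow> laurent_on (region i j k \<rho>) (G i j k) (word i j k)"
proof -
  obtain \<rho>0 where \<rho>0: "laurent_on (region 1 2 3 \<rho>0) (\<lambda>z. Y z / Y_factor p1 p2 z) (word 1 2 3)"
    using expands_Y by (auto simp: expands_in_def laurent_on_def word_def)
  define \<rho> where "\<rho> = Max {1, \<rho>0, norm p1, norm p2}"
  have \<rho>: "1 \<le> \<rho>" "\<rho>0 \<le> \<rho>" "norm p1 \<le> \<rho>" "norm p2 \<le> \<rho>"
    unfolding \<rho>_def by (intro Max_ge; simp)+
  define G where "G i j k z = Y (vec3_perm i j k z) / Y_factor p1 p2 (vec3_perm i j k z)" for i j k z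
  have "laurent_on (region i j k \<rho>) (G i j k) (word i j k)" if ijk: "i \<noteq> j" "j \<noteq> k" "i \<noteq> k" for i j k
    unfolding laurent_on_def
  proof
    fix z assume z: "z \<in> region i j k \<rho>"
    have univ: "UNIV = {i, j, k}"
      by (rule sym, rule card_subset_eq) (use ijk in auto)
    have "z $ l \<noteq> 0" for l
      using z by (auto simp: region_def torus_def)
    then have "vec3_perm i j k z \<in> region 1 2 3 \<rho>"
      using z by (simp add: region_def torus_3)
    then have "vec3_perm i j k z \<in> region 1 2 3 \<rho>0"
      using \<rho>(2) norm_cone_antimono[of "{(1, 2), (2, 3)}" _ \<rho>0 \<rho>] unfolding region_eq_cone by blast
    from laurent_onD[OF \<rho>0 this]
    have "((\<lambda>n. word 1 2 3 n * monomial n (vec3_perm i j k z)) has_sum G i j k z) UNIV"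
      by (simp add: G_def)
    moreover have "monomial (vec3_perm i j k n) (vec3_perm i j k z) = monomial n z" for n
      unfolding monomial_3[of "vec3_perm i j k n"] unfolding monomial_def univ
      using ijk by (simp add: mult.assoc)
    moreover have "n = vec3_perm i j k (\<chi> l. if l = i then n $ 1 else if l = j then n $ 2 else n $ 3)"
      for n :: "int ^ 3"
      using ijk by (simp add: vec_eq_iff forall_3)
    moreover have "n = (\<chi> l. if l = i then vec3_perm i j k n $ 1 else
        if l = j then vec3_perm i j k n $ 2 else vec3_perm i j k n $ 3)" for n :: "int ^ 3"
      using univ by (auto simp: vec_eq_iff)
    ultimately show "((\<lambda>n. word i j k n * monomial n z) has_sum G i j k z) UNIV"
      by (subst has_sum_reindex_bij_witness[where j = "vec3_perm i j k" and
            i = "\<lambda>n. \<chi> l. if l = i then n $ 1 else if l = j then n $ 2 else n $ 3"])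
         (simp_all add: word_def)
  qed
  moreover have "G 1 2 3 = (\<lambda>z. Y z / Y_factor p1 p2 z)"
  proof -
    have "vec3_perm 1 2 3 z = z" for z :: "complex ^ 3"
      by (simp add: vec_eq_iff forall_3)
    then show ?thesis by (simp add: G_def fun_eq_iff)
  qed
  ultimately show thesis
    using that \<rho> by blast
qed

lemma laurent_on_cleared:
  assumes "laurent_on U F (word i j k)" "U \<subseteq> torus"
  shows "laurent_on U (\<lambda>z. denom i j k z * F z) (cleared i j k)"
  unfolding denom_def cleared_def mult.assoc by (intro laurent_on_quad assms)

text \<open>Each exponent \<open>n\<close> has \<open>n\<^sub>1 \<ge> n\<^sub>3\<close> or \<open>n\<^sub>3 \<ge> n\<^sub>1\<close>, so that its monomial is dominated by the value at
  a point of the region \<open>|z\<^sub>1| \<ggreater> |z\<^sub>2| \<ggreater> |z\<^sub>3|\<close> or of the opposite region.\<close>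

lemma cleared_summable:
  assumes z: "z \<in> torus"
  shows "(\<lambda>n. cleared 1 2 3 n * monomial n z) summable_on UNIV"
proof -
  obtain \<rho> G where \<rho>: "\<rho> \<ge> 1"
    and word: "\<And>i j k. i \<noteq> j \<Longrightarrow> j \<noteq> k \<Longrightarrow> i \<noteq> k \<Longrightarrow> laurent_on (region i j k \<rho>) (G i j k) (word i j k)"
    by (rule laurent_on_word) blast
  have torus: "region i j k \<rho> \<subseteq> torus" for i j k
    by (auto simp: region_def)
  have L123: "laurent_on (region 1 2 3 \<rho>) (\<lambda>z. denom 1 2 3 z * G 1 2 3 z) (cleared 1 2 3)"
    by (intro laurent_on_cleared word torus) auto
  have L321: "laurent_on (region 3 2 1 \<rho>) (\<lambda>z. denom 3 2 1 z * G 3 2 1 z) (cleared 3 2 1)"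
    by (intro laurent_on_cleared word torus) auto
  have z0: "norm (z $ l) > 0" for l
    using z by (simp add: torus_def)
  \<comment> \<open>The product of the two sums dominates every quotient
    \<open>norm (z $ i) / norm (z $ j)\<close>, which gives \<open>less\<close> for all pairs at
    once.\<close>
  define \<mu> where "\<mu> = 1 + \<rho> * (\<Sum>i\<in>UNIV. norm (z $ i)) * (\<Sum>j\<in>UNIV. inverse (norm (z $ j)))"
  have ge: "\<rho> * (\<Sum>i\<in>UNIV. norm (z $ i)) * (\<Sum>j\<in>UNIV. inverse (norm (z $ j))) \<ge> 0"
    using \<rho> by (intro mult_nonneg_nonneg sum_nonneg) auto
  then have \<mu>: "\<mu> \<ge> 1" by (simp add: \<mu>_def)
  have less: "\<rho> * norm (z $ i) < \<mu> * norm (z $ j)" for i j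
  proof -
    have "\<rho> * norm (z $ i) * inverse (norm (z $ j)) \<le>
        \<rho> * (\<Sum>i\<in>UNIV. norm (z $ i)) * (\<Sum>j\<in>UNIV. inverse (norm (z $ j)))"
      using \<rho> by (intro mult_mono mult_nonneg_nonneg member_le_sum sum_nonneg) auto
    then have "\<rho> * norm (z $ i) * inverse (norm (z $ j)) < \<mu>"
      by (simp add: \<mu>_def)
    then show ?thesis
      using z0[of j] by (simp add: field_simps)
  qed
  \<comment> \<open>Scaling the outer coordinates by \<open>s\<close> and \<open>1 / s\<close>
    multiplies a monomial by \<open>s powi (n $ 1 - n $ 3)\<close>. The choice
    \<open>s = \<mu>\<close> leads into the region 1, 2, 3 and \<open>s = 1 / \<mu>\<close> into the
    opposite one.\<close>
  define w :: "real \<Rightarrow> complex ^ 3" where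
    "w s = (\<chi> l. if l = 1 then s * z $ l else if l = 2 then z $ l else z $ l / s)" for s
  have w_nth: "w s $ 1 = s * z $ 1" "w s $ 2 = z $ 2" "w s $ 3 = z $ 3 / s" for s
    by (simp_all add: w_def)
  have "norm (w \<mu> $ 1) > \<rho> * norm (w \<mu> $ 2)" "norm (w \<mu> $ 2) > \<rho> * norm (w \<mu> $ 3)"
    using less[of 2 1] less[of 3 2] \<mu> by (simp_all add: w_nth norm_mult norm_divide field_simps)
  then have w123: "w \<mu> \<in> region 1 2 3 \<rho>"
    using z \<mu> by (simp add: region_def torus_3 w_nth)
  have "norm (w (1 / \<mu>) $ 3) > \<rho> * norm (w (1 / \<mu>) $ 2)" "norm (w (1 / \<mu>) $ 2) > \<rho> * norm (w (1 / \<mu>) $ 1)"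
    using less[of 2 3] less[of 1 2] \<mu> by (simp_all add: w_nth norm_mult norm_divide field_simps)
  then have w321: "w (1 / \<mu>) \<in> region 3 2 1 \<rho>"
    using z \<mu> by (simp add: region_def torus_3 w_nth)
  have mono: "norm (monomial n (w s)) = norm (monomial n z) * s powi (n $ 1 - n $ 3)" if "s > 0" for n s
    using that by (simp add: monomial_3 w_nth norm_mult norm_power_int norm_divide power_int_mult_distrib
        power_int_divide_distrib power_int_diff)
  have "(\<lambda>n. norm (cleared 1 2 3 n * monomial n (w \<mu>))) summable_on UNIV"
    by (rule has_sum_imp_norm_summable[OF laurent_onD[OF L123 w123]])
  moreover have "(\<lambda>n. norm (cleared 3 2 1 n * monomial n (w (1 / \<mu>)))) summable_on UNIV"
    by (rule has_sum_imp_norm_summable[OF laurent_onD[OF L321 w321]])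
  ultimately have dominating: "(\<lambda>n. norm (cleared 1 2 3 n * monomial n (w \<mu>)) +
      norm (cleared 3 2 1 n * monomial n (w (1 / \<mu>)))) summable_on UNIV"
    by (rule summable_on_add)
  have "norm (cleared 1 2 3 n * monomial n z) \<le> norm (cleared 1 2 3 n * monomial n (w \<mu>)) +
      norm (cleared 3 2 1 n * monomial n (w (1 / \<mu>)))" for n
  proof -
    have "norm (monomial n z) \<le> norm (monomial n (w \<mu>)) + norm (monomial n (w (1 / \<mu>)))"
    proof (cases "n $ 1 \<ge> n $ 3")
      case True
      then have "1 \<le> \<mu> powi (n $ 1 - n $ 3)"
        using \<mu> by (intro one_le_power_int) auto
      then have "norm (monomial n z) \<le> norm (monomial n (w \<mu>))"
        using \<mu> mult_left_mono[of 1 _ "norm (monomial n z)"] by (simp add: mono)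
      then show ?thesis by (simp add: add_increasing2)
    next
      case False
      then have "1 \<le> \<mu> powi (n $ 3 - n $ 1)"
        using \<mu> by (intro one_le_power_int) auto
      moreover have "(1 / \<mu>) powi (n $ 1 - n $ 3) = \<mu> powi (n $ 3 - n $ 1)"
        using \<mu> by (simp add: power_int_divide_distrib power_int_diff)
      ultimately have "norm (monomial n z) \<le> norm (monomial n (w (1 / \<mu>)))"
        using \<mu> mono[where s = "1 / \<mu>" and n = n]
          mult_left_mono[of 1 "\<mu> powi (n $ 3 - n $ 1)" "norm (monomial n z)"]
        by (metis mult.right_neutral norm_ge_zero zero_less_divide_1_iff less_le_trans zero_less_one)
      then show ?thesis by (simp add: add_increasing)
    qed
    from mult_left_mono[OF this, of "norm (cleared 1 2 3 n)"] show ?thesis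
      by (simp add: cleared_signs norm_mult distrib_left)
  qed
  then have "(\<lambda>n. norm (cleared 1 2 3 n * monomial n z)) summable_on UNIV"
    by (rule Infinite_Sum.abs_summable_on_comparison_test'[OF dominating])
  then show ?thesis
    by (rule abs_summable_summable)
qed

section \<open>The sum of the cleared series and its factorisation through \<open>Y\<close>\<close>

definition H :: "complex ^ 3 \<Rightarrow> complex" where
  "H z = (\<Sum>\<^sub>\<infinity>n. cleared 1 2 3 n * monomial n z)"

lemma laurent_on_H: "laurent_on torus H (cleared 1 2 3)"
  unfolding laurent_on_def H_def using cleared_summable by (simp add: has_sum_infsum)

lemma denom_nz:
  assumes z: "z \<in> region i j k \<rho>" and \<rho>: "\<rho> \<ge> 1" "norm p1 \<le> \<rho>" "norm p2 \<le> \<rho>"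
  shows "denom i j k z \<noteq> 0"
proof -
  have "z \<in> norm_cone (chain i j k) \<rho>"
    using z region_subset_cone[OF \<rho>(1)] by blast
  from norm_cone_lin_nz[OF this] \<rho>(2,3) show ?thesis
    by (simp add: denom_def quad_poly_def)
qed

text \<open>Division by \<open>denom\<close> is done pointwise, where it does not vanish, and not on
  formal series, where it would be ambiguous. All orders thereby become expansions of one function
  \<open>H\<close> over their own denominators.\<close>

lemma expands_on_word:
  assumes ijk: "i \<noteq> j" "j \<noteq> k" "i \<noteq> k"
    and sign: "\<And>n. cleared i j k n = s * cleared 1 2 3 n"
  shows "expands_on (chain i j k) (\<lambda>z. s * H z * inverse (denom i j k z)) (word i j k)"
proof -
  obtain \<rho> G where \<rho>: "\<rho> \<ge> 1" "norm p1 \<le> \<rho>" "norm p2 \<le> \<rho>"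
    and word: "\<And>i j k. i \<noteq> j \<Longrightarrow> j \<noteq> k \<Longrightarrow> i \<noteq> k \<Longrightarrow> laurent_on (region i j k \<rho>) (G i j k) (word i j k)"
    by (rule laurent_on_word) blast
  have torus: "region i j k \<rho> \<subseteq> torus"
    by (auto simp: region_def)
  have "laurent_on (region i j k \<rho>) (\<lambda>z. s * H z * inverse (denom i j k z)) (word i j k)"
  proof (rule laurent_on_cong[OF word[OF ijk]])
    fix z assume z: "z \<in> region i j k \<rho>"
    have "((\<lambda>n. cleared i j k n * monomial n z) has_sum denom i j k z * G i j k z) UNIV"
      using laurent_onD[OF laurent_on_cleared[OF word[OF ijk] torus] z] .
    moreover have "((\<lambda>n. s * (cleared 1 2 3 n * monomial n z)) has_sum s * H z) UNIV"
      using z torus by (intro has_sum_cmult_right laurent_onD[OF laurent_on_H]) auto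
    ultimately have "denom i j k z * G i j k z = s * H z"
      unfolding sign mult.assoc by (rule has_sum_unique)
    then show "G i j k z = s * H z * inverse (denom i j k z)"
      using denom_nz[OF z \<rho>] by (simp add: field_simps)
  qed
  then have "expands_in i j k (\<lambda>z. s * H z * inverse (denom i j k z)) (word i j k)"
    unfolding expands_in_def laurent_on_def using \<rho>(1) by (intro exI[of _ \<rho>]) auto
  then show ?thesis by (simp add: expands_in_iff)
qed

definition slice :: "3 \<Rightarrow> complex ^ 3 \<Rightarrow> complex \<Rightarrow> complex ^ 3" where
  "slice i z w = (\<chi> j. if j = i then w else z $ j)"

lemma holomorphic_on_slice_H:
  assumes z: "z \<in> torus"
  shows "(\<lambda>w. H (slice i z w)) holomorphic_on - {0}"
proof (rule holomorphic_on_graded_sum[where a = "\<lambda>n. cleared 1 2 3 n * monomial n (slice i z 1)" and g = "\<lambda>n. n $ i"])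
  fix w :: complex assume "w \<noteq> 0"
  then have "slice i z w \<in> torus"
    using z by (auto simp: slice_def torus_def)
  from laurent_onD[OF laurent_on_H this]
  have "((\<lambda>n. cleared 1 2 3 n * monomial n (slice i z w)) has_sum H (slice i z w)) UNIV" .
  moreover have "monomial n (slice i z w) = monomial n (slice i z 1) * w powi (n $ i)" for n
    by (simp add: monomial_def slice_def prod.remove[of UNIV i])
  ultimately show "((\<lambda>n. cleared 1 2 3 n * monomial n (slice i z 1) * w powi n $ i) has_sum H (slice i z w)) UNIV"
    by (simp add: mult.assoc)
qed

text \<open>The one-variable identity theorem on the punctured plane, applied to agreement outside a
  disc. \<open>Y\<close> is given as holomorphic in each variable separately, so equality spreads
  one coordinate at a time.\<close>

lemma H_slice_eq:
  assumes z: "z \<in> torus"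
    and eq: "\<And>w. norm w > \<sigma> \<Longrightarrow> H (slice i z w) = Y (slice i z w) * vandermonde (slice i z w)"
  shows "H z = Y z * vandermonde z"
proof -
  define F where "F w = H (slice i z w)" for w
  define F' where "F' w = Y (slice i z w) * vandermonde (slice i z w)" for w
  have "F (z $ i) = F' (z $ i)"
  proof (rule analytic_continuation_open[where f = F and g = F' and s = "- cball 0 (max \<sigma> 0)" and s' = "- {0}"])
    show "connected (- {0 :: complex})"
      by (rule connected_punctured_universe) simp
    have "of_real (max \<sigma> 0 + 1) \<in> - cball (0 :: complex) (max \<sigma> 0)"
      by simp
    then show "- cball (0 :: complex) (max \<sigma> 0) \<noteq> {}" by blast
    show "F holomorphic_on - {0}"
      unfolding F_def by (rule holomorphic_on_slice_H[OF z])
    have "(\<lambda>w. slice i z w $ j) holomorphic_on - {0}" for j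
      by (cases "j = i") (simp_all add: slice_def)
    moreover have "(\<lambda>w. Y (slice i z w)) holomorphic_on - {0}"
      using holomorphic_Y z by (simp add: holomorphic_on_torus_def slice_def)
    ultimately show "F' holomorphic_on - {0}"
      unfolding F'_def vandermonde_def by (intro holomorphic_intros)
    show "F w = F' w" if "w \<in> - cball 0 (max \<sigma> 0)" for w
      using that by (auto simp: F_def F'_def intro: eq)
    show "z $ i \<in> - {0}"
      using z by (simp add: torus_def)
  qed auto
  moreover have "slice i z (z $ i) = z"
    by (simp add: slice_def vec_eq_iff)
  ultimately show ?thesis
    by (simp add: F_def F'_def)
qed

lemma H_eq:
  assumes z: "z \<in> torus"
  shows "H z = Y z * vandermonde z"
proof -
  obtain \<rho> G where \<rho>: "\<rho> \<ge> 1" "norm p1 \<le> \<rho>" "norm p2 \<le> \<rho>"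
    and G: "G 1 2 3 = (\<lambda>z. Y z / Y_factor p1 p2 z)"
    and word: "\<And>i j k. i \<noteq> j \<Longrightarrow> j \<noteq> k \<Longrightarrow> i \<noteq> k \<Longrightarrow> laurent_on (region i j k \<rho>) (G i j k) (word i j k)"
    by (rule laurent_on_word) blast
  have torus: "region 1 2 3 \<rho> \<subseteq> torus"
    by (auto simp: region_def)
  have region: "H z = Y z * vandermonde z" if z: "z \<in> region 1 2 3 \<rho>" for z
  proof -
    have L: "laurent_on (region 1 2 3 \<rho>) (\<lambda>z. denom 1 2 3 z * (Y z / Y_factor p1 p2 z)) (cleared 1 2 3)"
      using laurent_on_cleared[OF word[of 1 2 3] torus] by (simp add: G)
    have "H z = denom 1 2 3 z * (Y z / Y_factor p1 p2 z)"
      using laurent_onD[OF laurent_on_H] laurent_onD[OF L z] z torus has_sum_unique by blast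
    moreover have "Y_factor p1 p2 z = denom 1 2 3 z / vandermonde z"
      by (simp add: Y_factor_def denom_def quad_poly_def vandermonde_def)
    ultimately show ?thesis
      using denom_nz[OF z \<rho>] by simp
  qed
  \<comment> \<open>Freeing the first coordinate removes the comparison of 1 with 2; freeing the
    second one afterwards removes the comparison of 2 with 3.\<close>
  have first: "H z = Y z * vandermonde z" if z: "z \<in> torus" and less: "\<rho> * norm (z $ 3) < norm (z $ 2)" for z
  proof (rule H_slice_eq[OF z, where i = 1 and \<sigma> = "\<rho> * norm (z $ 2)"], rule region)
    fix w :: complex assume w: "norm w > \<rho> * norm (z $ 2)"
    moreover have "\<rho> * norm (z $ 2) \<ge> 0" using \<rho>(1) by simp
    ultimately have "w \<noteq> 0" by auto
    then show "slice 1 z w \<in> region 1 2 3 \<rho>"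
      using w z less by (simp add: region_def slice_def torus_3)
  qed
  show ?thesis
  proof (rule H_slice_eq[OF z, where i = 2 and \<sigma> = "\<rho> * norm (z $ 3)"], rule first)
    fix w :: complex assume w: "norm w > \<rho> * norm (z $ 3)"
    moreover have "\<rho> * norm (z $ 3) \<ge> 0" using \<rho>(1) by simp
    ultimately have "w \<noteq> 0" by auto
    then show "slice 2 z w \<in> torus"
      using z by (simp add: slice_def torus_3)
    show "\<rho> * norm (slice 2 z w $ 3) < norm (slice 2 z w $ 2)"
      using w by (simp add: slice_def)
  qed
qed

end

section \<open>The coefficient functions\<close>

text \<open>The hypothesis \<open>N * c = B + M * d\<close> says that \<open>N * c\<close> and
  \<open>B\<close> agree where \<open>d = 0\<close>. The first summand then carries the whole pole
  along \<open>d\<close>, and the second has none.\<close>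

lemma inverse_split:
  fixes A B c d N M :: complex
  assumes "A \<noteq> 0" "B \<noteq> 0" "c \<noteq> 0" "d \<noteq> 0" and "N * c = B + M * d"
  shows "N / (A * B * d) = 1 / (A * c * d) + M / (A * c * B)"
proof -
  have "N / (A * B * d) = (N * c) / (A * B * c * d)"
    using assms(1-4) by simp
  also have "\<dots> = 1 / (A * c * d) + M / (A * c * B)"
    unfolding assms(5) using assms(1-4) by (simp add: field_simps)
  finally show ?thesis .
qed

lemma inverse_cubic_partial_fractions:
  fixes w x a b c :: complex
  assumes "x \<noteq> 0" "a \<noteq> b" "a \<noteq> c" "b \<noteq> c" "w - a * x \<noteq> 0" "w - b * x \<noteq> 0" "w - c * x \<noteq> 0"
  shows "1 / ((w - a * x) * (w - b * x) * (w - c * x)) =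
    (1 / ((a - b) * (a - c)) / (w - a * x) + 1 / ((b - a) * (b - c)) / (w - b * x) +
     1 / ((c - a) * (c - b)) / (w - c * x)) / x ^ 2"
proof -
  have general: "1 / (A * B * C) = (1 / (s * t) / A + 1 / (- s * v) / B + 1 / (t * v) / C) / X"
    if "A \<noteq> 0" "B \<noteq> 0" "C \<noteq> 0" "s \<noteq> 0" "t \<noteq> 0" "v \<noteq> 0" "X \<noteq> 0"
      and eq: "v * (B * C) - t * (A * C) + s * (A * B) = s * t * v * X" for A B C s t v X :: complex
  proof -
    have "1 / (A * B * C) = s * t * v * X / (s * t * v * X * (A * B * C))"
      using that(1-7) by simp
    also have "\<dots> = v * (B * C) / (s * t * v * X * (A * B * C)) - t * (A * C) / (s * t * v * X * (A * B * C)) +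
        s * (A * B) / (s * t * v * X * (A * B * C))"
      unfolding eq[symmetric] by (simp only: diff_divide_distrib add_divide_distrib)
    also have "v * (B * C) / (s * t * v * X * (A * B * C)) = 1 / (s * t) / A / X"
      using that(1-7) by simp
    also have "t * (A * C) / (s * t * v * X * (A * B * C)) = - (1 / (- s * v) / B / X)"
      using that(1-7) by simp
    also have "s * (A * B) / (s * t * v * X * (A * B * C)) = 1 / (t * v) / C / X"
      using that(1-7) by simp
    finally show ?thesis
      by (simp add: add_divide_distrib diff_divide_distrib)
  qed
  have "(b - c) * ((w - b * x) * (w - c * x)) - (a - c) * ((w - a * x) * (w - c * x)) +
      (a - b) * ((w - a * x) * (w - b * x)) = (a - b) * (a - c) * (b - c) * x ^ 2"
    by algebra
  then have "1 / ((w - a * x) * (w - b * x) * (w - c * x)) = (1 / ((a - b) * (a - c)) / (w - a * x) +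
      1 / (- (a - b) * (b - c)) / (w - b * x) + 1 / ((a - c) * (b - c)) / (w - c * x)) / x ^ 2"
    using assms by (intro general) auto
  moreover have "(c - a) * (c - b) = (a - c) * (b - c)"
    by algebra
  ultimately show ?thesis by simp
qed

locale generic_parameter =
  fixes q :: complex
  assumes q_nz: "q \<noteq> 0" and generic: "\<And>n::nat. n > 0 \<Longrightarrow> q ^ n \<noteq> 1"
begin

lemma q_distinct: "1 \<noteq> q" "1 \<noteq> q ^ 2" "q \<noteq> q ^ 2"
  using generic[of 1] generic[of 2] q_nz by (auto simp: power2_eq_square)

text \<open>The residue of \<open>1 / ((w - 1) (w - q) (w - q ^ 2))\<close> at
  \<open>w = q ^ i\<close>.\<close>

definition residue_coeff :: "nat \<Rightarrow> complex" where
  "residue_coeff i = (\<Prod>j\<in>{..<3} - {i}. inverse (q ^ i - q ^ j))"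

text \<open>Kept in partial fractions because each summand is a product of two geometric series;
  \<open>kernel_eq\<close> recovers the product form.\<close>

definition kernel :: "complex ^ 3 \<Rightarrow> complex" where
  "kernel z = (\<Sum>i<3. residue_coeff i * kernel2 (q ^ i) (inverse q) z)"

lemma residue_coeff_simps:
  "residue_coeff 0 = 1 / ((1 - q) * (1 - q ^ 2))"
  "residue_coeff (Suc 0) = 1 / ((q - 1) * (q - q ^ 2))"
  "residue_coeff 2 = 1 / ((q ^ 2 - 1) * (q ^ 2 - q))"
proof -
  have "{..<3} - {0} = {1, 2::nat}" "{..<3} - {Suc 0} = {0, 2::nat}" "{..<3} - {2} = {0, 1::nat}"
    by auto
  then show "residue_coeff 0 = 1 / ((1 - q) * (1 - q ^ 2))"
    "residue_coeff (Suc 0) = 1 / ((q - 1) * (q - q ^ 2))"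
    "residue_coeff 2 = 1 / ((q ^ 2 - 1) * (q ^ 2 - q))"
    by (simp_all add: residue_coeff_def divide_inverse)
qed

lemma residue_coeff_nz: "residue_coeff i \<noteq> 0" if "i < 3"
proof -
  have "i = 0 \<or> i = Suc 0 \<or> i = 2" using that by auto
  then show ?thesis
    using q_distinct by (auto simp: residue_coeff_simps)
qed

lemma kernel_eq:
  assumes "z $ 1 \<noteq> 0" "z $ 3 - z $ 1 \<noteq> 0" "z $ 3 - q * z $ 1 \<noteq> 0" "z $ 3 - q ^ 2 * z $ 1 \<noteq> 0"
  shows "kernel z = 1 / ((z $ 3 - z $ 1) * (z $ 3 - q * z $ 1) * (z $ 3 - q ^ 2 * z $ 1) * (z $ 1 - inverse q * z $ 2))"
proof -
  have "kernel z = (1 / ((1 - q) * (1 - q ^ 2)) / (z $ 3 - 1 * z $ 1) +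
      1 / ((q - 1) * (q - q ^ 2)) / (z $ 3 - q * z $ 1) +
      1 / ((q ^ 2 - 1) * (q ^ 2 - q)) / (z $ 3 - q ^ 2 * z $ 1)) / (z $ 1) ^ 2 * inverse (z $ 1 - inverse q * z $ 2)"
    by (simp add: kernel_def numeral_3_eq_3 residue_coeff_simps[unfolded numeral_2_eq_2]
        kernel2_def divide_inverse power_inverse numeral_2_eq_2 algebra_simps)
  also have "(1 / ((1 - q) * (1 - q ^ 2)) / (z $ 3 - 1 * z $ 1) +
      1 / ((q - 1) * (q - q ^ 2)) / (z $ 3 - q * z $ 1) +
      1 / ((q ^ 2 - 1) * (q ^ 2 - q)) / (z $ 3 - q ^ 2 * z $ 1)) / (z $ 1) ^ 2 =
      1 / ((z $ 3 - 1 * z $ 1) * (z $ 3 - q * z $ 1) * (z $ 3 - q ^ 2 * z $ 1))"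
    using assms q_distinct by (intro inverse_cubic_partial_fractions[symmetric]) auto
  finally show ?thesis
    by (simp add: divide_inverse mult.assoc)
qed

text \<open>No denominator relates \<open>z $ 1\<close> and \<open>z $ 2\<close>, so the expansion
  needs only that \<open>z $ 3\<close> dominates both and is the same on \<open>chain 3 1 2\<close>
  and \<open>chain 3 2 1\<close>. In \<open>rest12\<close> the variable \<open>z $ 3\<close> is
  dominated instead.\<close>

definition rest3 :: "complex ^ 3 \<Rightarrow> complex" where
  "rest3 z = (- (q ^ 3 + 1) * z $ 3 + q ^ 3 * z $ 1 + q ^ 2 * z $ 2) *
     inverse (z $ 3 - 1 * z $ 1) * inverse (z $ 3 - q * z $ 1) * inverse (z $ 3 - q ^ 2 * z $ 1) *
     inverse (z $ 3 - q ^ 2 * z $ 2) * inverse (z $ 3 - inverse q * z $ 2)"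

definition rest12 :: "complex ^ 3 \<Rightarrow> complex" where
  "rest12 z = (q ^ 2 * z $ 1 + q * z $ 2 + - (1 + q ^ 3) * z $ 3) *
     inverse (z $ 3 - 1 * z $ 1) * inverse (z $ 3 - q * z $ 1) * inverse (z $ 3 - q ^ 2 * z $ 1) *
     inverse (z $ 2 - q ^ 2 * z $ 3) * inverse (z $ 2 - inverse q * z $ 3)"

lemma expandable_rest3: "expandable {(3, 1), (3, 2)} rest3"
  unfolding rest3_def using q_nz
  by (intro expandable_mult expandable_add expandable_scale expandable_coordinate expandable_inverse_lin) auto

lemma expandable_rest12: "expandable {(1, 3), (2, 3)} rest12"
  unfolding rest12_def using q_nz
  by (intro expandable_mult expandable_add expandable_scale expandable_coordinate expandable_inverse_lin) auto

definition regular :: "complex ^ 3 \<Rightarrow> bool" where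
  "regular z \<longleftrightarrow> z \<in> torus \<and>
     (\<forall>i j. i \<noteq> j \<longrightarrow> (\<forall>a\<in>{1, q, q ^ 2, inverse q}. z $ i - a * z $ j \<noteq> 0))"

lemma regular_nz:
  assumes "regular z" "i \<noteq> j"
  shows "z $ i - z $ j \<noteq> 0" "z $ i - q * z $ j \<noteq> 0" "z $ i - q ^ 2 * z $ j \<noteq> 0"
    "z $ i - inverse q * z $ j \<noteq> 0"
  using assms unfolding regular_def by force+

lemma regular_coordinate_nz: "regular z \<Longrightarrow> z $ i \<noteq> 0"
  by (simp add: regular_def torus_def)

text \<open>The left side is the common quotient of coefficient and denominator for the words 312
  and 321. Setting \<open>z_2 = q z_1\<close> turns \<open>(z_3 - q^2 z_2)(z_3 - z_2 / q)\<close>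
  into \<open>(z_3 - q^3 z_1)(z_3 - z_1)\<close>, which is why \<open>inverse_split\<close> applies
  with \<open>c = z_3 - z_1\<close>.\<close>

lemma kernel_rest3:
  assumes z: "regular z"
  shows "(z $ 3 - q ^ 3 * z $ 1) / ((z $ 3 - q * z $ 1) * (z $ 3 - q ^ 2 * z $ 1) *
      ((z $ 3 - q ^ 2 * z $ 2) * (z $ 3 - inverse q * z $ 2)) * (z $ 1 - inverse q * z $ 2)) =
    kernel z + rest3 z"
proof -
  note nz = regular_nz[OF z] regular_coordinate_nz[OF z]
  have qi: "q * inverse q = 1" using q_nz by simp
  have "(z $ 3 - q ^ 3 * z $ 1) / ((z $ 3 - q * z $ 1) * (z $ 3 - q ^ 2 * z $ 1) *
      ((z $ 3 - q ^ 2 * z $ 2) * (z $ 3 - inverse q * z $ 2)) * (z $ 1 - inverse q * z $ 2)) =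
    1 / ((z $ 3 - q * z $ 1) * (z $ 3 - q ^ 2 * z $ 1) * (z $ 3 - z $ 1) * (z $ 1 - inverse q * z $ 2)) +
    (- (q ^ 3 + 1) * z $ 3 + q ^ 3 * z $ 1 + q ^ 2 * z $ 2) /
      ((z $ 3 - q * z $ 1) * (z $ 3 - q ^ 2 * z $ 1) * (z $ 3 - z $ 1) *
       ((z $ 3 - q ^ 2 * z $ 2) * (z $ 3 - inverse q * z $ 2)))"
  proof (rule inverse_split)
    show "(z $ 3 - q ^ 3 * z $ 1) * (z $ 3 - z $ 1) = (z $ 3 - q ^ 2 * z $ 2) * (z $ 3 - inverse q * z $ 2) +
        (- (q ^ 3 + 1) * z $ 3 + q ^ 3 * z $ 1 + q ^ 2 * z $ 2) * (z $ 1 - inverse q * z $ 2)"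
      using qi by algebra
  qed (use nz in auto)
  also have "\<dots> = kernel z + rest3 z"
    using nz by (subst kernel_eq) (simp_all add: rest3_def divide_inverse mult_ac)
  finally show ?thesis .
qed

text \<open>The same for the words 123 and 213: at \<open>z_2 = q z_1\<close> the product
  \<open>(z_2 - q^2 z_3)(z_2 - z_3 / q)\<close> equals
  \<open>- (z_1 - q z_3)(z_3 - q^2 z_1)\<close>, so now \<open>c = z_3 - q^2 z_1\<close>, and the
  same kernel appears.\<close>

lemma kernel_rest12:
  assumes z: "regular z"
  shows "- (z $ 1 - q * z $ 3) / ((z $ 3 - q * z $ 1) * (z $ 3 - z $ 1) *
      ((z $ 2 - q ^ 2 * z $ 3) * (z $ 2 - inverse q * z $ 3)) * (z $ 1 - inverse q * z $ 2)) =
    kernel z + rest12 z"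
proof -
  note nz = regular_nz[OF z] regular_coordinate_nz[OF z]
  have qi: "q * inverse q = 1" using q_nz by simp
  have "- (z $ 1 - q * z $ 3) / ((z $ 3 - q * z $ 1) * (z $ 3 - z $ 1) *
      ((z $ 2 - q ^ 2 * z $ 3) * (z $ 2 - inverse q * z $ 3)) * (z $ 1 - inverse q * z $ 2)) =
    1 / ((z $ 3 - q * z $ 1) * (z $ 3 - z $ 1) * (z $ 3 - q ^ 2 * z $ 1) * (z $ 1 - inverse q * z $ 2)) +
    (q ^ 2 * z $ 1 + q * z $ 2 + - (1 + q ^ 3) * z $ 3) /
      ((z $ 3 - q * z $ 1) * (z $ 3 - z $ 1) * (z $ 3 - q ^ 2 * z $ 1) *
       ((z $ 2 - q ^ 2 * z $ 3) * (z $ 2 - inverse q * z $ 3)))"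
  proof (rule inverse_split)
    show "- (z $ 1 - q * z $ 3) * (z $ 3 - q ^ 2 * z $ 1) =
        (z $ 2 - q ^ 2 * z $ 3) * (z $ 2 - inverse q * z $ 3) +
        (q ^ 2 * z $ 1 + q * z $ 2 + - (1 + q ^ 3) * z $ 3) * (z $ 1 - inverse q * z $ 2)"
      using qi by algebra
  qed (use nz in auto)
  also have "\<dots> = kernel z + rest12 z"
    using nz by (subst kernel_eq) (simp_all add: rest12_def divide_inverse mult_ac)
  finally show ?thesis .
qed

end

section \<open>Convolution with the expansions of the kernel\<close>

lemma expands_on_0: "expands_on R (\<lambda>z. 0) (\<lambda>n. 0)"
  by (rule expands_on_torus) (simp add: laurent_on_def)

lemma expands_on_sum:
  assumes "finite I" "\<And>i. i \<in> I \<Longrightarrow> expands_on R (F i) (r i)"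
  shows "expands_on R (\<lambda>z. \<Sum>i\<in>I. F i z) (\<lambda>n. \<Sum>i\<in>I. r i n)"
  using assms by (induction I) (auto intro: expands_on_0 expands_on_add)

text \<open>After the substitution \<open>k = n - m\<close> the geometric powers become the monomial
  of \<open>k\<close> at the point \<open>(1, inverse b, a)\<close>. A coefficient of the product is
  thus a partial sum of \<open>S\<close> at that point; the shift 4 is minus the degree of the
  kernel.\<close>

lemma series_mult_geom2:
  assumes a: "a \<noteq> 0" and b: "b \<noteq> 0"
  shows "series_mult (geom2 a b K L) S n =
    a powi (- n $ 3 - 1) * b powi (n $ 2) *
    infsum (\<lambda>k. S k * monomial k (vector [1, inverse b, a]))
      {k. k $ 1 + k $ 2 + k $ 3 = n $ 1 + n $ 2 + n $ 3 + 4 \<and> k $ 3 - n $ 3 - 1 \<in> K \<and> n $ 2 - k $ 2 \<in> L}"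
proof -
  define T where "T = {k :: int ^ 3. k $ 1 + k $ 2 + k $ 3 = n $ 1 + n $ 2 + n $ 3 + 4 \<and> k $ 3 - n $ 3 - 1 \<in> K \<and> n $ 2 - k $ 2 \<in> L}"
  define C where "C = a powi (- n $ 3 - 1) * b powi (n $ 2)"
  have "series_mult (geom2 a b K L) S n = (\<Sum>\<^sub>\<infinity>m. geom2 a b K L m * S (n - m))"
    by (simp add: series_mult_def)
  also have "\<dots> = (\<Sum>\<^sub>\<infinity>k. geom2 a b K L (n - k) * S k)"
    by (rule infsum_reindex_bij_witness[where i = "\<lambda>k. n - k" and j = "\<lambda>k. n - k"]) auto
  also have "\<dots> = (\<Sum>\<^sub>\<infinity>k\<in>T. C * (S k * monomial k (vector [1, inverse b, a])))"
  proof (rule infsum_cong_neutral)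
    fix k assume k: "k \<in> UNIV \<inter> T"
    then have "(n - k) $ 1 + (n - k) $ 2 + (n - k) $ 3 = - 4" "- (n - k) $ 3 - 1 \<in> K" "(n - k) $ 2 \<in> L"
      by (auto simp: T_def algebra_simps)
    then have "geom2 a b K L (n - k) = a powi (- (n - k) $ 3 - 1) * b powi ((n - k) $ 2)"
      by (simp add: geom2_def)
    also have "- (n - k) $ 3 - 1 = (- n $ 3 - 1) + k $ 3"
      by simp
    also have "(n - k) $ 2 = n $ 2 - k $ 2"
      by simp
    also have "a powi ((- n $ 3 - 1) + k $ 3) * b powi (n $ 2 - k $ 2) =
        C * monomial k (vector [1, inverse b, a])"
      using a b unfolding C_def power_int_add[OF disjI1[OF a]] power_int_diff[OF disjI1[OF b]]
      by (simp add: monomial_3 power_int_inverse divide_inverse)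
    finally show "geom2 a b K L (n - k) * S k = C * (S k * monomial k (vector [1, inverse b, a]))"
      by simp
  next
    fix k assume "k \<in> UNIV - T"
    then have "geom2 a b K L (n - k) = 0"
      by (auto simp: T_def geom2_def algebra_simps)
    then show "geom2 a b K L (n - k) * S k = 0" by simp
  qed simp
  also have "\<dots> = C * infsum (\<lambda>k. S k * monomial k (vector [1, inverse b, a])) T"
    by (rule infsum_cmult_right')
  finally show ?thesis
    by (simp add: C_def T_def)
qed

lemma infsum_split:
  fixes f :: "'a \<Rightarrow> complex"
  assumes "f summable_on UNIV"
  shows "infsum f {x. P x} = infsum f {x. P x \<and> Q x} + infsum f {x. P x \<and> \<not> Q x}"
proof -
  have "infsum f ({x. P x \<and> Q x} \<union> {x. P x \<and> \<not> Q x}) = infsum f {x. P x \<and> Q x} + infsum f {x. P x \<and> \<not> Q x}"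
    by (rule infsum_Un_disjoint) (auto intro: summable_on_subset[OF assms])
  moreover have "{x. P x \<and> Q x} \<union> {x. P x \<and> \<not> Q x} = {x. P x}"
    by auto
  ultimately show ?thesis by simp
qed

text \<open>The four ranges partition the exponents of one total degree. This is the coefficient
  form of the rule that a delta function evaluates its cofactor.\<close>

lemma series_mult_geom2_total:
  assumes a: "a \<noteq> 0" and b: "b \<noteq> 0"
    and S: "(\<lambda>k. S k * monomial k (vector [1, inverse b, a])) summable_on UNIV"
  shows "series_mult (geom2 a b {0..} {0..}) S n + series_mult (geom2 a b {0..} {..<0}) S n +
      series_mult (geom2 a b {..<0} {0..}) S n + series_mult (geom2 a b {..<0} {..<0}) S n =
    a powi (- n $ 3 - 1) * b powi (n $ 2) *
    infsum (\<lambda>k. S k * monomial k (vector [1, inverse b, a])) {k. k $ 1 + k $ 2 + k $ 3 = n $ 1 + n $ 2 + n $ 3 + 4}"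
proof -
  have ranges: "(k $ 3 - n $ 3 - 1 \<in> {0..}) = (n $ 3 < k $ 3)" "(k $ 3 - n $ 3 - 1 \<in> {..<0}) = (\<not> n $ 3 < k $ 3)"
    "(n $ 2 - k $ 2 \<in> {0..}) = (k $ 2 \<le> n $ 2)" "(n $ 2 - k $ 2 \<in> {..<0}) = (\<not> k $ 2 \<le> n $ 2)" for k :: "int ^ 3"
    by auto
  define D :: "int ^ 3 \<Rightarrow> bool" where "D k \<longleftrightarrow> k $ 1 + k $ 2 + k $ 3 = n $ 1 + n $ 2 + n $ 3 + 4" for k
  show ?thesis
    unfolding series_mult_geom2[OF a b] ranges D_def[symmetric] infsum_split[OF S, of D "\<lambda>k. n $ 3 < k $ 3"]
      infsum_split[OF S, of "\<lambda>k. D k \<and> n $ 3 < k $ 3" "\<lambda>k. k $ 2 \<le> n $ 2"]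
      infsum_split[OF S, of "\<lambda>k. D k \<and> \<not> n $ 3 < k $ 3" "\<lambda>k. k $ 2 \<le> n $ 2"]
    by (simp only: distrib_left conj_assoc add.assoc)
qed

section \<open>Assembly of the cubic relation\<close>

locale serre_currents = generic_parameter q + exchange_relations "q ^ 2" "inverse q" t Y
  for q :: complex and t :: "int \<Rightarrow> int \<Rightarrow> int \<Rightarrow> complex" and Y :: "complex ^ 3 \<Rightarrow> complex"
begin

lemma coeff312_denom:
  assumes z: "regular z"
  shows "coeff312 q (z $ 1) (z $ 2) (z $ 3) * inverse (denom 3 1 2 z) = kernel z + rest3 z"
proof -
  have general: "a * N * e / b * inverse ((c * a) * (d * f) * (e * g)) = N / (b * c * (d * f) * g)"
    if "a \<noteq> 0" "e \<noteq> 0" for a b c d e f g N :: complex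
    using that by (simp add: divide_inverse) (simp add: field_simps)
  have "coeff312 q (z $ 1) (z $ 2) (z $ 3) =
      (z $ 3 - inverse q * z $ 1) * (z $ 3 - q ^ 3 * z $ 1) * (z $ 1 - q ^ 2 * z $ 2) / (z $ 3 - q * z $ 1)"
    by (simp add: coeff312_def mult.commute)
  then show ?thesis
    unfolding kernel_rest3[OF z, symmetric] denom_def quad_poly_def
    using regular_nz[OF z] by (simp only:) (rule general, auto)
qed

lemma coeff321_denom:
  assumes z: "regular z"
  shows "coeff321 q (z $ 1) (z $ 2) (z $ 3) * inverse (denom 3 2 1 z) = kernel z + rest3 z"
proof -
  have general: "m * l * a * N / (g * b) * inverse ((d * f) * (c * a) * (m * l)) = N / (b * c * (d * f) * g)"
    if "a \<noteq> 0" "m \<noteq> 0" "l \<noteq> 0" for a b c d f g l m N :: complex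
    using that by (simp add: divide_inverse) (simp add: field_simps)
  have "coeff321 q (z $ 1) (z $ 2) (z $ 3) =
      (z $ 2 - q ^ 2 * z $ 1) * (z $ 2 - inverse q * z $ 1) * (z $ 3 - inverse q * z $ 1) * (z $ 3 - q ^ 3 * z $ 1) /
      ((z $ 1 - inverse q * z $ 2) * (z $ 3 - q * z $ 1))"
    by (simp add: coeff321_def mult.commute)
  then show ?thesis
    unfolding kernel_rest3[OF z, symmetric] denom_def quad_poly_def
    using regular_nz[OF z] by (simp only:) (rule general, auto)
qed

lemma coeff123_denom:
  assumes z: "regular z"
  shows "coeff123 q (z $ 1) (z $ 2) (z $ 3) * inverse (denom 1 2 3 z) = kernel z + rest12 z"
proof -
  \<comment> \<open>Here \<open>E = q z_1 - z_3 / q\<close> is \<open>- (z_3 - q^2 z_1) / q\<close>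
    and cancels a denominator of the coefficient; the remaining equations reverse
    \<open>z_3 - q z_1\<close> and \<open>z_3 - z_1\<close>, and the signs and powers of
    \<open>q\<close> leave just the minus sign in front of \<open>N\<close>.\<close>
  have general: "P * N * E * e / (u * c) * inverse ((e * g) * (P * r) * (b * b')) = - N / (s * v * (b * b') * g)"
    if "P \<noteq> 0" "e \<noteq> 0" "c \<noteq> 0" "E = - (inverse q * c)" "s = - (q * r)" "v = - u"
    for P N E e u c g r b b' s v :: complex
    using that q_nz by (simp add: divide_inverse) (simp add: field_simps)
  have "coeff123 q (z $ 1) (z $ 2) (z $ 3) =
      (z $ 1 - q ^ 2 * z $ 3) * (z $ 1 - q * z $ 3) * (q * z $ 1 - inverse q * z $ 3) * (z $ 1 - q ^ 2 * z $ 2) /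
      ((z $ 1 - z $ 3) * (z $ 3 - q ^ 2 * z $ 1))"
    by (simp add: coeff123_def mult.commute)
  then show ?thesis
    unfolding kernel_rest12[OF z, symmetric] denom_def quad_poly_def
    using regular_nz[OF z] q_nz by (simp only:) (rule general, auto simp: algebra_simps power2_eq_square)
qed

lemma coeff213_denom:
  assumes z: "regular z"
  shows "coeff213 q (z $ 1) (z $ 2) (z $ 3) * inverse (denom 2 1 3 z) = kernel z + rest12 z"
proof -
  have general: "P * N * E * m * l / (u * c * g) * inverse ((m * l) * (b * b') * (P * r)) = - N / (s * v * (b * b') * g)"
    if "P \<noteq> 0" "m \<noteq> 0" "l \<noteq> 0" "c \<noteq> 0" "E = - (inverse q * c)" "s = - (q * r)" "v = - u"
    for P N E u c g r b b' s v l m :: complex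
    using that q_nz by (simp add: divide_inverse) (simp add: field_simps)
  have "coeff213 q (z $ 1) (z $ 2) (z $ 3) =
      (z $ 1 - q ^ 2 * z $ 3) * (z $ 1 - q * z $ 3) * (q * z $ 1 - inverse q * z $ 3) *
      (z $ 2 - q ^ 2 * z $ 1) * (z $ 2 - inverse q * z $ 1) /
      ((z $ 1 - z $ 3) * (z $ 3 - q ^ 2 * z $ 1) * (z $ 1 - inverse q * z $ 2))"
    by (simp add: coeff213_def mult.commute)
  then show ?thesis
    unfolding kernel_rest12[OF z, symmetric] denom_def quad_poly_def
    using regular_nz[OF z] q_nz by (simp only:) (rule general, auto simp: algebra_simps power2_eq_square)
qed

lemma expandable_coeffs:
  "expandable (chain 3 1 2) (\<lambda>z. coeff312 q (z $ 1) (z $ 2) (z $ 3))"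
  "expandable (chain 3 2 1) (\<lambda>z. coeff321 q (z $ 1) (z $ 2) (z $ 3))"
  "expandable (chain 1 2 3) (\<lambda>z. coeff123 q (z $ 1) (z $ 2) (z $ 3))"
  "expandable (chain 2 1 3) (\<lambda>z. coeff213 q (z $ 1) (z $ 2) (z $ 3))"
proof -
  note intros = expandable_mult expandable_lin expandable_inverse_lin expandable_scale
  have "expandable (chain 3 1 2) (\<lambda>z. (z $ 3 - inverse q * z $ 1) * (z $ 3 - q ^ 3 * z $ 1) *
      (z $ 1 - q ^ 2 * z $ 2) * inverse (z $ 3 - q * z $ 1))"
    using q_nz by (intro intros) auto
  then show "expandable (chain 3 1 2) (\<lambda>z. coeff312 q (z $ 1) (z $ 2) (z $ 3))"
    by (simp add: coeff312_def divide_inverse mult.commute)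
  have "expandable (chain 3 2 1) (\<lambda>z. (z $ 2 - q ^ 2 * z $ 1) * (z $ 2 - inverse q * z $ 1) *
      (z $ 3 - inverse q * z $ 1) * (z $ 3 - q ^ 3 * z $ 1) *
      (inverse (z $ 1 - inverse q * z $ 2) * inverse (z $ 3 - q * z $ 1)))"
    using q_nz by (intro intros) auto
  then show "expandable (chain 3 2 1) (\<lambda>z. coeff321 q (z $ 1) (z $ 2) (z $ 3))"
    by (simp add: coeff321_def divide_inverse mult.commute)
  \<comment> \<open>Brings \<open>z_1 q - z_3 / q\<close> into the shape of a scaled linear form
    with leading coefficient 1.\<close>
  have scaled: "q * (v - inverse q ^ 2 * w) = v * q - w * inverse q" for v w
    using q_nz by (simp add: algebra_simps power2_eq_square)
  have "expandable (chain 1 2 3) (\<lambda>z. (z $ 1 - q ^ 2 * z $ 3) * (z $ 1 - q * z $ 3) *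
      (q * (z $ 1 - inverse q ^ 2 * z $ 3)) * (z $ 1 - q ^ 2 * z $ 2) *
      (inverse (z $ 1 - 1 * z $ 3) * inverse (z $ 3 - q ^ 2 * z $ 1)))"
    using q_nz by (intro intros) auto
  then show "expandable (chain 1 2 3) (\<lambda>z. coeff123 q (z $ 1) (z $ 2) (z $ 3))"
    unfolding scaled by (simp add: coeff123_def divide_inverse mult.commute)
  have "expandable (chain 2 1 3) (\<lambda>z. (z $ 1 - q ^ 2 * z $ 3) * (z $ 1 - q * z $ 3) *
      (q * (z $ 1 - inverse q ^ 2 * z $ 3)) * (z $ 2 - q ^ 2 * z $ 1) * (z $ 2 - inverse q * z $ 1) *
      (inverse (z $ 1 - 1 * z $ 3) * inverse (z $ 3 - q ^ 2 * z $ 1) * inverse (z $ 1 - inverse q * z $ 2)))"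
    using q_nz by (intro intros) auto
  then show "expandable (chain 2 1 3) (\<lambda>z. coeff213 q (z $ 1) (z $ 2) (z $ 3))"
    unfolding scaled by (simp add: coeff213_def divide_inverse mult.commute)
qed

lemma norm_cone_regular:
  obtains \<rho> where "\<And>R z. (\<And>i j. i \<noteq> j \<Longrightarrow> (i, j) \<in> R \<or> (j, i) \<in> R) \<Longrightarrow> z \<in> norm_cone R \<rho> \<Longrightarrow> regular z"
proof -
  \<comment> \<open>The inverses are included because a cone may compare a pair in either
    direction.\<close>
  define \<rho> where "\<rho> = Max {1, norm q, norm (q ^ 2), norm (inverse q), norm (inverse (q ^ 2))}"
  have \<rho>: "1 \<le> \<rho>" "norm q \<le> \<rho>" "norm (q ^ 2) \<le> \<rho>" "norm (inverse q) \<le> \<rho>" "norm (inverse (q ^ 2)) \<le> \<rho>"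
    unfolding \<rho>_def by (intro Max_ge; simp)+
  show thesis
  proof (rule that)
    fix R z assume R: "\<And>i j. i \<noteq> j \<Longrightarrow> (i, j) \<in> R \<or> (j, i) \<in> R" and z: "z \<in> norm_cone R \<rho>"
    have "z $ i - a * z $ j \<noteq> 0" if "i \<noteq> j" and a: "a \<in> {1, q, q ^ 2, inverse q}" for i j a
    proof -
      have an: "norm a \<le> \<rho>" "norm (inverse a) \<le> \<rho>" "a \<noteq> 0"
        using a \<rho> q_nz by auto
      show ?thesis
        using R[OF that(1)]
      proof
        assume "(i, j) \<in> R"
        then show ?thesis using norm_cone_lin_nz[OF z _ an(1)] by blast
      next
        assume "(j, i) \<in> R"
        then have "z $ j - inverse a * z $ i \<noteq> 0" using norm_cone_lin_nz[OF z _ an(2)] by blast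
        moreover have "z $ i - a * z $ j = - a * (z $ j - inverse a * z $ i)"
          using an(3) by (simp add: algebra_simps)
        ultimately show ?thesis using an(3) by simp
      qed
    qed
    then show "regular z"
      using z by (auto simp: regular_def norm_cone_def)
  qed
qed

definition convolution :: "int set \<Rightarrow> int set \<Rightarrow> int ^ 3 \<Rightarrow> complex" where
  "convolution K L n =
     (\<Sum>i<3. residue_coeff i * series_mult (geom2 (q ^ i) (inverse q) K L) (cleared 1 2 3) n)"

lemma convolution_expands_on:
  assumes "\<And>i. expands_on R (\<lambda>z. s * kernel2 (q ^ i) (inverse q) z) (geom2 (q ^ i) (inverse q) K L)"
  shows "expands_on R (\<lambda>z. s * kernel z * H z) (convolution K L)"
proof -
  have "expands_on R (\<lambda>z. \<Sum>i<3. residue_coeff i * ((s * kernel2 (q ^ i) (inverse q) z) * H z)) (convolution K L)"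
    unfolding convolution_def
    by (intro expands_on_sum expands_on_scale expands_on_mult assms expands_on_torus laurent_on_H) simp
  moreover have "(\<Sum>i<3. residue_coeff i * ((s * kernel2 (q ^ i) (inverse q) z) * H z)) = s * kernel z * H z" for z
    by (simp add: kernel_def sum_distrib_left sum_distrib_right mult_ac)
  ultimately show ?thesis by simp
qed

text \<open>\<open>s\<close> is the sign of the permutation and \<open>u\<close> the sign with which
  the kernel expands on this chain; \<open>u * u = 1\<close> carries \<open>u\<close> to the other
  side. Uniqueness of expansions makes it unnecessary to know the coefficients of
  \<open>C\<close>.\<close>

lemma cubic_word_eq:
  assumes ijk: "i \<noteq> j" "j \<noteq> k" "i \<noteq> k"
    and C: "expandable (chain i j k) (\<lambda>z. C (z $ 1) (z $ 2) (z $ 3))"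
    and sign: "\<And>n. cleared i j k n = s * cleared 1 2 3 n"
    and quotient: "\<And>z. regular z \<Longrightarrow> C (z $ 1) (z $ 2) (z $ 3) * inverse (denom i j k z) = kernel z + B z"
    and conv: "expands_on (chain i j k) (\<lambda>z. u * kernel z * H z) (convolution K L)"
    and rest: "expands_on (chain i j k) (\<lambda>z. B z * H z) r" and "u * u = 1"
  shows "series_mult (expansion i j k (\<lambda>z. C (z $ 1) (z $ 2) (z $ 3))) (word i j k) n =
    s * u * convolution K L n + s * r n"
proof -
  have univ: "{i, j, k} = UNIV"
    by (rule card_subset_eq) (use ijk in auto)
  have total: "(l, m) \<in> chain i j k \<or> (m, l) \<in> chain i j k" if "l \<noteq> m" for l m
  proof -
    have "l \<in> {i, j, k}" "m \<in> {i, j, k}"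
      unfolding univ by auto
    with that show ?thesis by blast
  qed
  obtain c where c: "expands_on (chain i j k) (\<lambda>z. C (z $ 1) (z $ 2) (z $ 3)) c"
    using C by (auto simp: expandable_def)
  have "expands_on (chain i j k) (\<lambda>z. C (z $ 1) (z $ 2) (z $ 3) * (s * H z * inverse (denom i j k z)))
      (series_mult c (word i j k))"
    by (intro expands_on_mult c expands_on_word ijk sign)
  moreover obtain \<rho> where \<rho>: "\<And>R z. (\<And>i j. i \<noteq> j \<Longrightarrow> (i, j) \<in> R \<or> (j, i) \<in> R) \<Longrightarrow> z \<in> norm_cone R \<rho> \<Longrightarrow> regular z"
    by (rule norm_cone_regular) blast
  have "C (z $ 1) (z $ 2) (z $ 3) * (s * H z * inverse (denom i j k z)) =
      s * u * (u * kernel z * H z) + s * (B z * H z)" if "z \<in> norm_cone (chain i j k) \<rho>" for z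
  proof -
    have reg: "regular z"
      using that by (rule \<rho>[rotated]) (rule total)
    have "C (z $ 1) (z $ 2) (z $ 3) * (s * H z * inverse (denom i j k z)) =
        (C (z $ 1) (z $ 2) (z $ 3) * inverse (denom i j k z)) * (s * H z)"
      by simp
    also have "\<dots> = (u * u * kernel z + B z) * (s * H z)"
      using quotient[OF reg] \<open>u * u = 1\<close> by simp
    finally show ?thesis
      by (simp add: algebra_simps)
  qed
  ultimately have "expands_on (chain i j k) (\<lambda>z. s * u * (u * kernel z * H z) + s * (B z * H z))
      (series_mult c (word i j k))"
    by (rule expands_on_cong)
  moreover have "expands_on (chain i j k) (\<lambda>z. s * u * (u * kernel z * H z) + s * (B z * H z))
      (\<lambda>n. s * u * convolution K L n + s * r n)"
    by (intro expands_on_add expands_on_scale conv rest)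
  ultimately have "series_mult c (word i j k) = (\<lambda>n. s * u * convolution K L n + s * r n)"
    using ijk by (rule expands_on_chain_unique)
  then show ?thesis
    using expansion_eqI[OF c ijk] by simp
qed

definition cubic_sum :: "int ^ 3 \<Rightarrow> complex" where
  "cubic_sum n =
     series_mult (expansion 3 1 2 (\<lambda>z. coeff312 q (z $ 1) (z $ 2) (z $ 3))) (word 3 1 2) n +
     series_mult (expansion 3 2 1 (\<lambda>z. coeff321 q (z $ 1) (z $ 2) (z $ 3))) (word 3 2 1) n -
     series_mult (expansion 1 2 3 (\<lambda>z. coeff123 q (z $ 1) (z $ 2) (z $ 3))) (word 1 2 3) n -
     series_mult (expansion 2 1 3 (\<lambda>z. coeff213 q (z $ 1) (z $ 2) (z $ 3))) (word 2 1 3) n"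

definition line_point :: "nat \<Rightarrow> complex \<Rightarrow> complex ^ 3" where
  "line_point i u = vector [u, u * q, u * q ^ i]"

text \<open>The coefficient of \<open>u powi d\<close> in the one-variable Laurent series of
  \<open>H (line_point i u)\<close>.\<close>

definition degree_part :: "nat \<Rightarrow> int \<Rightarrow> complex" where
  "degree_part i d =
     infsum (\<lambda>k. cleared 1 2 3 k * monomial k (line_point i 1)) {k. k $ 1 + k $ 2 + k $ 3 = d}"

lemma line_point_torus: "u \<noteq> 0 \<Longrightarrow> line_point i u \<in> torus"
  using q_nz by (simp add: line_point_def torus_3)

lemma has_sum_line_point:
  assumes "u \<noteq> 0"
  shows "((\<lambda>k. cleared 1 2 3 k * monomial k (line_point i 1) * u powi (k $ 1 + k $ 2 + k $ 3)) has_sum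
    H (line_point i u)) UNIV"
proof -
  have "monomial k (line_point i u) = monomial k (line_point i 1) * u powi (k $ 1 + k $ 2 + k $ 3)" for k
    using assms by (simp add: monomial_3 line_point_def power_int_mult_distrib power_int_add mult_ac)
  then show ?thesis
    using laurent_onD[OF laurent_on_H line_point_torus[OF assms, of i]] by (simp add: mult.assoc)
qed

lemma degree_part_eq_0_iff:
  "(\<forall>d. degree_part i d = 0) \<longleftrightarrow> (\<forall>u. u \<noteq> 0 \<longrightarrow> H (line_point i u) = 0)"
proof (intro iffI allI impI)
  fix u :: complex assume "\<forall>d. degree_part i d = 0" "u \<noteq> 0"
  then show "H (line_point i u) = 0"
    by (intro graded_parts_0_imp_has_sum_0[OF has_sum_line_point]) (auto simp: degree_part_def)
next
  fix d assume H0: "\<forall>u. u \<noteq> 0 \<longrightarrow> H (line_point i u) = 0"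
  have "infsum (\<lambda>k. cleared 1 2 3 k * monomial k (line_point i 1)) {k \<in> UNIV. k $ 1 + k $ 2 + k $ 3 = d} = 0"
  proof (rule graded_part_eq_0)
    fix u :: complex assume "norm u = 1"
    then have "u \<noteq> 0" by auto
    with H0 has_sum_line_point[OF this, of i]
    show "((\<lambda>k. cleared 1 2 3 k * monomial k (line_point i 1) * u powi (k $ 1 + k $ 2 + k $ 3)) has_sum 0) UNIV"
      by simp
  qed
  then show "degree_part i d = 0"
    by (simp add: degree_part_def)
qed

text \<open>The permutation sign, the kernel sign and the sign in the cubic relation multiply to +1
  for all four words. The remainders lack the kernel sign and cancel between 312 and 321 and between
  123 and 213.\<close>

lemma cubic_sum_eq_convolution:
  "cubic_sum n = convolution {0..} {0..} n + convolution {0..} {..<0} n +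
     convolution {..<0} {0..} n + convolution {..<0} {..<0} n"
proof -
  obtain b3 where "expands_on {(3, 1), (3, 2)} rest3 b3"
    using expandable_rest3 by (auto simp: expandable_def)
  then have "expands_on {(3, 1), (3, 2)} (\<lambda>z. rest3 z * H z) (series_mult b3 (cleared 1 2 3))"
    by (intro expands_on_mult expands_on_torus[OF laurent_on_H])
  then have rest3: "expands_on (chain 3 1 2) (\<lambda>z. rest3 z * H z) (series_mult b3 (cleared 1 2 3))"
    "expands_on (chain 3 2 1) (\<lambda>z. rest3 z * H z) (series_mult b3 (cleared 1 2 3))"
    by (auto elim: expands_on_mono)
  obtain b12 where "expands_on {(1, 3), (2, 3)} rest12 b12"
    using expandable_rest12 by (auto simp: expandable_def)
  then have "expands_on {(1, 3), (2, 3)} (\<lambda>z. rest12 z * H z) (series_mult b12 (cleared 1 2 3))"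
    by (intro expands_on_mult expands_on_torus[OF laurent_on_H])
  then have rest12: "expands_on (chain 1 2 3) (\<lambda>z. rest12 z * H z) (series_mult b12 (cleared 1 2 3))"
    "expands_on (chain 2 1 3) (\<lambda>z. rest12 z * H z) (series_mult b12 (cleared 1 2 3))"
    by (auto elim: expands_on_mono)
  have nz: "q ^ i \<noteq> 0" "inverse q \<noteq> 0" for i
    using q_nz by auto
  note geo = geom2_expands_on[OF nz]
  have "series_mult (expansion 3 1 2 (\<lambda>z. coeff312 q (z $ 1) (z $ 2) (z $ 3))) (word 3 1 2) n =
      1 * 1 * convolution {0..} {0..} n + 1 * series_mult b3 (cleared 1 2 3) n"
    by (rule cubic_word_eq[OF _ _ _ expandable_coeffs(1) _ coeff312_denom convolution_expands_on rest3(1)])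
       (use geo(1) in \<open>simp_all add: cleared_signs\<close>)
  moreover have "series_mult (expansion 3 2 1 (\<lambda>z. coeff321 q (z $ 1) (z $ 2) (z $ 3))) (word 3 2 1) n =
      (- 1) * (- 1) * convolution {0..} {..<0} n + (- 1) * series_mult b3 (cleared 1 2 3) n"
    by (rule cubic_word_eq[OF _ _ _ expandable_coeffs(2) _ coeff321_denom convolution_expands_on rest3(2)])
       (use geo(2) in \<open>simp_all add: cleared_signs\<close>)
  moreover have "series_mult (expansion 1 2 3 (\<lambda>z. coeff123 q (z $ 1) (z $ 2) (z $ 3))) (word 1 2 3) n =
      1 * (- 1) * convolution {..<0} {0..} n + 1 * series_mult b12 (cleared 1 2 3) n"
    by (rule cubic_word_eq[OF _ _ _ expandable_coeffs(3) _ coeff123_denom convolution_expands_on rest12(1)])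
       (use geo(3) in \<open>simp_all add: cleared_signs\<close>)
  moreover have "series_mult (expansion 2 1 3 (\<lambda>z. coeff213 q (z $ 1) (z $ 2) (z $ 3))) (word 2 1 3) n =
      (- 1) * 1 * convolution {..<0} {..<0} n + (- 1) * series_mult b12 (cleared 1 2 3) n"
    by (rule cubic_word_eq[OF _ _ _ expandable_coeffs(4) _ coeff213_denom convolution_expands_on rest12(2)])
       (use geo(4) in \<open>simp_all add: cleared_signs\<close>)
  ultimately show ?thesis
    by (simp add: cubic_sum_def)
qed

lemma cubic_sum_eq:
  "cubic_sum n = (\<Sum>i<3. residue_coeff i * ((q ^ i) powi (- n $ 3 - 1) * inverse q powi (n $ 2) *
     degree_part i (n $ 1 + n $ 2 + n $ 3 + 4)))"
proof -
  have total: "series_mult (geom2 (q ^ i) (inverse q) {0..} {0..}) (cleared 1 2 3) n +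
      series_mult (geom2 (q ^ i) (inverse q) {0..} {..<0}) (cleared 1 2 3) n +
      series_mult (geom2 (q ^ i) (inverse q) {..<0} {0..}) (cleared 1 2 3) n +
      series_mult (geom2 (q ^ i) (inverse q) {..<0} {..<0}) (cleared 1 2 3) n =
    (q ^ i) powi (- n $ 3 - 1) * inverse q powi (n $ 2) * degree_part i (n $ 1 + n $ 2 + n $ 3 + 4)" for i
  proof -
    have "vector [1, inverse (inverse q), q ^ i] = line_point i 1"
      by (simp add: line_point_def)
    then show ?thesis
      using series_mult_geom2_total[of "q ^ i" "inverse q" "cleared 1 2 3" n] q_nz
        cleared_summable[OF line_point_torus[of 1 i]]
      by (simp add: degree_part_def)
  qed
  show ?thesis
    unfolding cubic_sum_eq_convolution convolution_def sum.distrib[symmetric] distrib_left[symmetric] total ..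
qed

text \<open>\<open>H = Y \<cdot> vandermonde\<close> vanishes on the lines with \<open>z\<^sub>3 = z\<^sub>1\<close> or \<open>z\<^sub>3 = z\<^sub>2\<close>, so of the three
  poles of the kernel only \<open>z\<^sub>3 = q\<^sup>2 z\<^sub>1\<close> contributes.\<close>

lemma cubic_sum_eq_0_iff:
  "(\<forall>n. cubic_sum n = 0) \<longleftrightarrow> (\<forall>u. u \<noteq> 0 \<longrightarrow> Y (line_point 2 u) = 0)"
proof -
  have "\<forall>u. u \<noteq> 0 \<longrightarrow> H (line_point i u) = 0" if "i = 0 \<or> i = Suc 0" for i
    using that by (auto simp: H_eq[OF line_point_torus] vandermonde_def) (auto simp: line_point_def)
  then have 0: "degree_part i d = 0" if "i = 0 \<or> i = Suc 0" for i d
    using that degree_part_eq_0_iff by blast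
  have sum: "cubic_sum n = residue_coeff 2 * ((q ^ 2) powi (- n $ 3 - 1) * inverse q powi (n $ 2) *
      degree_part 2 (n $ 1 + n $ 2 + n $ 3 + 4))" for n
    unfolding cubic_sum_eq by (simp add: numeral_3_eq_3 0 numeral_2_eq_2)
  have "(\<forall>n. cubic_sum n = 0) \<longleftrightarrow> (\<forall>d. degree_part 2 d = 0)"
  proof (intro iffI allI)
    fix d assume "\<forall>n. cubic_sum n = 0"
    \<comment> \<open>The exponent \<open>d - 4\<close> compensates the degree -4 of the kernel; any
      exponent of this total degree would isolate \<open>degree_part 2 d\<close> up to a nonzero
      factor.\<close>
    then have "cubic_sum (vector [d - 4, 0, 0]) = 0" by blast
    then show "degree_part 2 d = 0"
      using q_nz residue_coeff_nz[of 2] by (simp add: sum)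
  qed (simp add: sum)
  also have "\<dots> \<longleftrightarrow> (\<forall>u. u \<noteq> 0 \<longrightarrow> H (line_point 2 u) = 0)"
    by (rule degree_part_eq_0_iff)
  also have "\<dots> \<longleftrightarrow> (\<forall>u. u \<noteq> 0 \<longrightarrow> Y (line_point 2 u) = 0)"
  proof -
    have "vandermonde (line_point 2 u) \<noteq> 0" if "u \<noteq> 0" for u
      using that q_distinct by (simp add: vandermonde_def line_point_def)
    then show ?thesis
      by (simp add: H_eq[OF line_point_torus])
  qed
  finally show ?thesis .
qed

end

section \<open>Passage from matrix coefficients to currents\<close>

lemma cubic_relation_iff:
  fixes x :: "int \<Rightarrow> 'v \<Rightarrow> 'v" and f :: "'v \<Rightarrow> complex" and q :: complex
  assumes q: "q \<noteq> 0" "\<And>n::nat. n > 0 \<Longrightarrow> q ^ n \<noteq> 1"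
    and exchange: "\<And>g m n w. g = f \<or> (\<exists>k. g = f \<circ> x k) \<Longrightarrow>
      g (x (m + 2) (x n w)) - (q ^ 2 + inverse q) * g (x (m + 1) (x (n + 1) w)) + q ^ 2 * inverse q * g (x m (x (n + 2) w)) =
      - (q ^ 2 * inverse q * g (x n (x (m + 2) w)) - (q ^ 2 + inverse q) * g (x (n + 1) (x (m + 1) w)) + g (x (n + 2) (x m w)))"
    and Y: "is_Y_function (q ^ 2) (inverse q) x f v Y"
  shows "(\<forall>z\<in>torus. z $ 1 = z $ 2 * inverse q \<and> z $ 2 * inverse q = z $ 3 * inverse q ^ 2 \<longrightarrow> Y z = 0) \<longleftrightarrow>
    cubic_relation q x f v"
proof -
  define t where "t a b c = f (x a (x b (x c v)))" for a b c
  have triple: "triple x f v i j k = (\<lambda>n. t (- (n $ i)) (- (n $ j)) (- (n $ k)))" for i j k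
    by (simp add: triple_def t_def fun_eq_iff)
  interpret serre_currents q t Y
  proof unfold_locales
    show "t (m + 2) n k - (q ^ 2 + inverse q) * t (m + 1) (n + 1) k + q ^ 2 * inverse q * t m (n + 2) k =
       - (q ^ 2 * inverse q * t n (m + 2) k - (q ^ 2 + inverse q) * t (n + 1) (m + 1) k + t (n + 2) m k)" for m n k
      unfolding t_def by (rule exchange) simp
    show "t k (m + 2) n - (q ^ 2 + inverse q) * t k (m + 1) (n + 1) + q ^ 2 * inverse q * t k m (n + 2) =
       - (q ^ 2 * inverse q * t k n (m + 2) - (q ^ 2 + inverse q) * t k (n + 1) (m + 1) + t k (n + 2) m)" for m n k
      \<comment> \<open>The relation for the two right currents is tested against
        \<open>f \<circ> x k\<close>, which explains the second kind of functional in the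
        hypothesis.\<close>
      unfolding t_def using exchange[of "f \<circ> x k" m n v] by auto
    show "holomorphic_on_torus Y" "expands_in 1 2 3 (\<lambda>z. Y z / Y_factor (q ^ 2) (inverse q) z)
        (\<lambda>n. t (- (n $ 1)) (- (n $ 2)) (- (n $ 3)))"
      using Y by (simp_all add: is_Y_function_def triple)
  qed (use q in auto)
  have "word i j k = triple x f v i j k" for i j k
    by (simp add: triple word_def fun_eq_iff)
  then have "cubic_relation q x f v \<longleftrightarrow> (\<forall>n. cubic_sum n = 0)"
    by (simp add: cubic_relation_def cubic_term_def cubic_sum_def)
  also have "\<dots> \<longleftrightarrow> (\<forall>u. u \<noteq> 0 \<longrightarrow> Y (line_point 2 u) = 0)"
    by (rule cubic_sum_eq_0_iff)
  also have "\<dots> \<longleftrightarrow> (\<forall>z\<in>torus. z $ 1 = z $ 2 * inverse q \<and> z $ 2 * inverse q = z $ 3 * inverse q ^ 2 \<longrightarrow> Y z = 0)"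
  proof safe
    fix z assume Y0: "\<forall>u. u \<noteq> 0 \<longrightarrow> Y (line_point 2 u) = 0"
      and z: "z \<in> torus" "z $ 1 = z $ 2 * inverse q" "z $ 2 * inverse q = z $ 3 * inverse q ^ 2"
    then have "z = line_point 2 (z $ 1)" "z $ 1 \<noteq> 0"
      using q(1) by (auto simp: line_point_def vec_eq_iff forall_3 torus_3 field_simps power2_eq_square)
    with Y0 show "Y z = 0" by metis
  next
    fix u :: complex
    assume Y0: "\<forall>z\<in>torus. z $ 1 = z $ 2 * inverse q \<and> z $ 2 * inverse q = z $ 3 * inverse q ^ 2 \<longrightarrow> Y z = 0"
      and u: "u \<noteq> 0"
    have "line_point 2 u $ 1 = line_point 2 u $ 2 * inverse q"
      "line_point 2 u $ 2 * inverse q = line_point 2 u $ 3 * inverse q ^ 2"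
      using q(1) by (simp_all add: line_point_def field_simps power2_eq_square)
    with Y0 line_point_torus[OF u, of 2] show "Y (line_point 2 u) = 0" by blast
  qed
  finally show ?thesis ..
qed

theorem proposition4p6:
  fixes scale :: "complex \<Rightarrow> 'v::ab_group_add \<Rightarrow> 'v"
    and q h p1 p2 :: complex
    and r R :: real
    and gp gm :: "int \<Rightarrow> complex"
    and W :: "('v \<Rightarrow> complex) set"
    and parity :: "'v \<Rightarrow> 'v"
    and xp xm a b \<phi> \<psi> qc :: "int \<Rightarrow> 'v \<Rightarrow> 'v"
    and c :: "'v \<Rightarrow> 'v"
    and Yp Ym :: "('v \<Rightarrow> complex) \<Rightarrow> 'v \<Rightarrow> complex ^ 3 \<Rightarrow> complex"
  assumes "q \<noteq> 0" and q_generic: "\<And>n::nat. n > 0 \<Longrightarrow> q ^ n \<noteq> 1"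
    and "p1 = q ^ 2" and "p2 = inverse q"
    and "Uq_representation scale q h p1 p2 r R gp gm W parity xp xm a b \<phi> \<psi> qc c"
    and "\<And>f v. f \<in> W \<Longrightarrow> is_Y_function p1 p2 xp f v (Yp f v)"
    and "\<And>f v. f \<in> W \<Longrightarrow> is_Y_function (inverse p1) (inverse p2) xm f v (Ym f v)"
  shows
    "((\<forall>f\<in>W. \<forall>v. \<forall>z\<in>torus.
         z $ 1 = z $ 2 * q powi (-1) \<and> z $ 2 * q powi (-1) = z $ 3 * q powi (-2) \<longrightarrow> Yp f v z = 0) \<and>
      (\<forall>f\<in>W. \<forall>v. \<forall>z\<in>torus.
         z $ 1 = z $ 2 * q \<and> z $ 2 * q = z $ 3 * q ^ 2 \<longrightarrow> Ym f v z = 0))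
     \<longleftrightarrow>
     ((\<forall>f\<in>W. \<forall>v. cubic_relation q xp f v) \<and>
      (\<forall>f\<in>W. \<forall>v. cubic_relation (inverse q) xm f v))"
proof -
  interpret Uq_representation scale q h p1 p2 r R gp gm W parity xp xm a b \<phi> \<psi> qc c
    by fact
  have hom: "module_hom scale (*) g" if "g \<in> W" for g
    using functional_linear[OF that] by (simp add: linear_iff_module_hom)
  have stable_x: "g \<in> W" if "f \<in> W" "g = f \<or> (\<exists>k. g = f \<circ> xp k) \<or> (\<exists>k. g = f \<circ> xm k)" for f g
    using that stable by auto
  have xp: "g (xp (m + 2) (xp n w)) - (p1 + p2) * g (xp (m + 1) (xp (n + 1) w)) + p1 * p2 * g (xp m (xp (n + 2) w)) =
      - (p1 * p2 * g (xp n (xp (m + 2) w)) - (p1 + p2) * g (xp (n + 1) (xp (m + 1) w)) + g (xp (n + 2) (xp m w)))"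
    if "g \<in> W" for g m n w
  proof -
    interpret g: module_hom scale "(*)" g by (rule hom[OF that])
    show ?thesis
      using arg_cong[OF xp_xp[of m n w], of g] by (simp add: g.add g.diff g.neg g.scale)
  qed
  have xm: "p1 * p2 * g (xm (m + 2) (xm n w)) - (p1 + p2) * g (xm (m + 1) (xm (n + 1) w)) + g (xm m (xm (n + 2) w)) =
      - (g (xm n (xm (m + 2) w)) - (p1 + p2) * g (xm (n + 1) (xm (m + 1) w)) + p1 * p2 * g (xm (n + 2) (xm m w)))"
    if "g \<in> W" for g m n w
  proof -
    interpret g: module_hom scale "(*)" g by (rule hom[OF that])
    show ?thesis
      using arg_cong[OF xm_xm[of m n w], of g] by (simp add: g.add g.diff g.neg g.scale)
  qed
  \<comment> \<open>Division by \<open>p1 * p2 = q\<close> turns the quadratic relation of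
    \<open>xm\<close> into that of \<open>xp\<close> with the parameters
    \<open>1 / p1 = inverse q ^ 2\<close> and \<open>1 / p2 = q\<close>, so
    \<open>cubic_relation_iff\<close> applies at \<open>inverse q\<close>.\<close>
  have invert: "s - (inverse q ^ 2 + inverse (inverse q)) * s' + inverse q ^ 2 * inverse (inverse q) * s'' =
      - (inverse q ^ 2 * inverse (inverse q) * u - (inverse q ^ 2 + inverse (inverse q)) * u' + u'')"
    if "p1 * p2 * s - (p1 + p2) * s' + s'' = - (u - (p1 + p2) * u' + p1 * p2 * u'')" for s s' s'' u u' u'' :: complex
  proof -
    have "q ^ 2 * p2 * s - (q ^ 2 + p2) * s' + s'' = - (u - (q ^ 2 + p2) * u' + q ^ 2 * p2 * u'')"
      using that assms(3) by simp
    moreover have "q * p2 = 1"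
      using assms(1,4) by simp
    ultimately have "s - (p2 ^ 2 + q) * s' + p2 ^ 2 * q * s'' = - (p2 ^ 2 * q * u - (p2 ^ 2 + q) * u' + u'')"
      by algebra
    then show ?thesis
      by (simp add: assms(4))
  qed
  have plus: "(\<forall>z\<in>torus. z $ 1 = z $ 2 * q powi (-1) \<and> z $ 2 * q powi (-1) = z $ 3 * q powi (-2) \<longrightarrow> Yp f v z = 0) \<longleftrightarrow>
      cubic_relation q xp f v" if "f \<in> W" for f v
  proof -
    have "q powi (-1) = inverse q" "q powi (-2) = inverse q ^ 2"
      by (simp_all add: power_int_minus power_inverse)
    moreover have "(\<forall>z\<in>torus. z $ 1 = z $ 2 * inverse q \<and> z $ 2 * inverse q = z $ 3 * inverse q ^ 2 \<longrightarrow> Yp f v z = 0) \<longleftrightarrow>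
        cubic_relation q xp f v"
    proof (rule cubic_relation_iff[OF assms(1) q_generic])
      show "is_Y_function (q ^ 2) (inverse q) xp f v (Yp f v)"
        using assms(6)[OF that] assms(3,4) by simp
    qed (assumption, rule xp[unfolded assms(3,4)], rule stable_x[OF that], blast)
    ultimately show ?thesis by simp
  qed
  have minus: "(\<forall>z\<in>torus. z $ 1 = z $ 2 * q \<and> z $ 2 * q = z $ 3 * q ^ 2 \<longrightarrow> Ym f v z = 0) \<longleftrightarrow>
      cubic_relation (inverse q) xm f v" if "f \<in> W" for f v
  proof -
    have "(\<forall>z\<in>torus. z $ 1 = z $ 2 * inverse (inverse q) \<and>
        z $ 2 * inverse (inverse q) = z $ 3 * inverse (inverse q) ^ 2 \<longrightarrow> Ym f v z = 0) \<longleftrightarrow>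
      cubic_relation (inverse q) xm f v"
    proof (rule cubic_relation_iff)
      show "is_Y_function (inverse q ^ 2) (inverse (inverse q)) xm f v (Ym f v)"
        using assms(7)[OF that] assms(3,4) by (simp add: power_inverse)
      show "inverse q ^ n \<noteq> 1" if "n > 0" for n
        using q_generic[OF that] by (simp add: power_inverse)
    qed (use assms(1) in simp, rule invert, rule xm, rule stable_x[OF that], blast)
    then show ?thesis by simp
  qed
  show ?thesis
    using plus minus by blast
qed

end
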